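(* Let $G$ be a free group, and let $H\leq G$ be a subgroup of finite index. Let $G$ act on a standard probability space $(X,\mu)$ by measure preserving bijections, and let $H$ act on $(X,\mu)$ by restricting the action of $G$. If $G\curvearrowright(X,\mu)$ is measurably conjugate to a Markov process, then $H\curvearrowright(X,\mu)$ is measurably conjugate to a Markov process as well.
   Context: All groups are countable (free groups need not be finitely generated). Two measure preserving actions of $G$ on standard probability spaces $(X,\mu)$, $(Y,\nu)$ are measurably conjugate if there is a measure space isomorphism $\phi:(X,\mu)\to(Y,\nu)$ with $\phi(g\cdot x)=g\cdot\phi(x)$ for all $g\in G$ and $\mu$-a.e. $x$. For a partition $\alpha$, $g\cdot\alpha=\{g\cdot A: A\in\alpha\}$; for $F\subseteq G$, $F\cdot\alpha=\bigvee_{f\in F}f\cdot\alpha$, which for infinite $F$ denotes the $\sigma$-algebra generated by the sets in all the $f\cdot\alpha$. A countable measurable partition $\alpha$ is generating if $G\cdot\alpha$ contains every measurable set up to null sets. Markov process: let $S$ be a free generating set of a free group $G$. For $s\in S\cup S^{-1}$ let $\mathrm{RPast}_S(1_G,s)$ be the set of $g\in G$ such that the unique non-self-intersecting path from $g$ to $s$ in the right $S$-Cayley graph of $G$ (vertex set $G$, edges $(g,gs')$, $s'\in S\cup S^{-1}$) passes through $1_G$; equivalently, the set of $g$ whose reduced $S$-word does not begin on the left with $s$. A measure preserving action of $G$ on a standard probability space $(X,\mu)$ is an $(S,\alpha)$-Markov process, where $\alpha$ is a countable measurable partition, if $\alpha$ is generating and for every $A\in\alpha$, $s\in S\cup S^{-1}$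 and $\mu$-a.e. $x\in X$, $$\mathbb{E}\big(\chi_{s\cdot A}\mid \mathrm{RPast}_S(1_G,s)\cdot\alpha\big)(x)=\mathbb{E}(\chi_{s\cdot A}\mid\alpha)(x),$$ where $\mathbb{E}(\cdot\mid\cdot)$ is conditional expectation. It is a Markov process if it is an $(S,\alpha)$-Markov process for some free generating set $S$ of $G$ and some $\alpha$. *)

theory Defs
  imports "HOL-Probability.Probability" "HOL-Algebra.Algebra"
begin

section \<open>Free groups\<close>

text \<open>
  A word over \<open>S\<close> is a list of formal letters: \<open>(s, True)\<close> stands for \<open>s\<close> and
  \<open>(s, False)\<close> for its inverse. Keeping the sign formal matters: with letters taken in
  \<open>S \<union> S\<inverse>\<close> inside the group, an involution would count as a free generator.
\<close>

fun letter_value :: "('g, 'm) monoid_scheme \<Rightarrow> 'g \<times> bool \<Rightarrow> 'g" where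
  "letter_value G (s, b) = (if b then s else inv\<^bsub>G\<^esub> s)"

definition word_value :: "('g, 'm) monoid_scheme \<Rightarrow> ('g \<times> bool) list \<Rightarrow> 'g" where
  "word_value G w = foldr (\<lambda>l g. letter_value G l \<otimes>\<^bsub>G\<^esub> g) w \<one>\<^bsub>G\<^esub>"

definition reduced_words :: "'g set \<Rightarrow> ('g \<times> bool) list set" where
  "reduced_words S =
     {w \<in> lists (S \<times> UNIV). successively (\<lambda>k l. \<not> (fst k = fst l \<and> snd k \<noteq> snd l)) w}"

definition free_generating_set :: "('g, 'm) monoid_scheme \<Rightarrow> 'g set \<Rightarrow> bool" where
  "free_generating_set G S \<longleftrightarrow>
     S \<subseteq> carrier G \<and> bij_betw (word_value G) (reduced_words S) (carrier G)"

definition free_group :: "('g, 'm) monoid_scheme \<Rightarrow> bool" where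
  "free_group G \<longleftrightarrow> group G \<and> (\<exists>S. free_generating_set G S)"

definition sym_gens :: "('g, 'm) monoid_scheme \<Rightarrow> 'g set \<Rightarrow> 'g set" where
  "sym_gens G S = S \<union> m_inv G ` S"

definition cayley_edge :: "('g, 'm) monoid_scheme \<Rightarrow> 'g set \<Rightarrow> 'g \<Rightarrow> 'g \<Rightarrow> bool" where
  "cayley_edge G S g h \<longleftrightarrow> g \<in> carrier G \<and> (\<exists>s\<in>sym_gens G S. h = g \<otimes>\<^bsub>G\<^esub> s)"

definition simple_path ::
  "('g, 'm) monoid_scheme \<Rightarrow> 'g set \<Rightarrow> 'g \<Rightarrow> 'g \<Rightarrow> 'g list \<Rightarrow> bool" where
  "simple_path G S g h p \<longleftrightarrow>
     p \<noteq> [] \<and> hd p = g \<and> last p = h \<and> distinct p \<and> successively (cayley_edge G S) p"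

text \<open>
  When \<open>S\<close> is a free generating set the Cayley graph is a tree, so the path quantified
  over below exists and is unique.
\<close>

definition RPast :: "('g, 'm) monoid_scheme \<Rightarrow> 'g set \<Rightarrow> 'g \<Rightarrow> 'g \<Rightarrow> 'g set" where
  "RPast G S u v = {g \<in> carrier G. \<exists>p. simple_path G S g v p \<and> u \<in> set p}"

section \<open>Measure preserving actions\<close>

definition standard_borel :: "'a measure \<Rightarrow> bool" where
  "standard_borel M \<longleftrightarrow>
     (\<exists>T. completely_metrizable_space T \<and> second_countable T \<and>
          topspace T = space M \<and> sets M = sigma_sets (topspace T) {U. openin T U})"

definition standard_prob_space :: "'a measure \<Rightarrow> bool" where
  "standard_prob_space M \<longleftrightarrow> standard_borel M \<and> prob_space M"

definition pmp_action ::
  "('g, 'm) monoid_scheme \<Rightarrow> 'a measure \<Rightarrow> ('g \<Rightarrow> 'a \<Rightarrow> 'a) \<Rightarrow> bool" where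
  "pmp_action G M a \<longleftrightarrow>
     standard_prob_space M \<and> group_action G (space M) a \<and>
     (\<forall>g\<in>carrier G. a g \<in> measurable M M \<and> distr M M (a g) = M)"

text \<open>An isomorphism of measure spaces is, as usual, one between conull measurable subsets.\<close>

definition measure_space_isomorphism ::
  "'a measure \<Rightarrow> 'b measure \<Rightarrow> ('a \<Rightarrow> 'b) \<Rightarrow> bool" where
  "measure_space_isomorphism M N f \<longleftrightarrow>
     (\<exists>A\<in>sets M. \<exists>B\<in>sets N.
        space M - A \<in> null_sets M \<and> space N - B \<in> null_sets N \<and>
        bij_betw f A B \<and>
        f \<in> measurable (restrict_space M A) (restrict_space N B) \<and>
        the_inv_into A f \<in> measurable (restrict_space N B) (restrict_space M A) \<and>
        distr (restrict_space M A) (restrict_space N B) f = restrict_space N B)"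

definition measurably_conjugate ::
  "('g, 'm) monoid_scheme \<Rightarrow> 'a measure \<Rightarrow> ('g \<Rightarrow> 'a \<Rightarrow> 'a) \<Rightarrow>
     'b measure \<Rightarrow> ('g \<Rightarrow> 'b \<Rightarrow> 'b) \<Rightarrow> bool" where
  "measurably_conjugate G M a N b \<longleftrightarrow>
     (\<exists>f. measure_space_isomorphism M N f \<and>
          (\<forall>g\<in>carrier G. AE x in M. f (a g x) = b g (f x)))"

section \<open>Markov processes\<close>

definition countable_partition :: "'a measure \<Rightarrow> 'a set set \<Rightarrow> bool" where
  "countable_partition M \<alpha> \<longleftrightarrow> countable \<alpha> \<and> \<alpha> \<subseteq> sets M \<and> partition_on (space M) \<alpha>"

text \<open>
  \<open>translates M a F \<alpha>\<close> carries the \<open>\<sigma>\<close>-algebra \<open>F \<cdot> \<alpha>\<close>, generated by the translates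
  \<open>f \<cdot> A\<close> with \<open>f \<in> F\<close> and \<open>A \<in> \<alpha>\<close>.
  It is of type measure because \<^const>\<open>real_cond_exp\<close> represents sub-\<open>\<sigma>\<close>-algebras that way;
  only its \<^const>\<open>sets\<close> are relevant.
\<close>

definition translates ::
  "'a measure \<Rightarrow> ('g \<Rightarrow> 'a \<Rightarrow> 'a) \<Rightarrow> 'g set \<Rightarrow> 'a set set \<Rightarrow> 'a measure" where
  "translates M a F \<alpha> = sigma (space M) (\<Union>f\<in>F. (\<lambda>A. a f ` A) ` \<alpha>)"

definition generating ::
  "('g, 'm) monoid_scheme \<Rightarrow> 'a measure \<Rightarrow> ('g \<Rightarrow> 'a \<Rightarrow> 'a) \<Rightarrow> 'a set set \<Rightarrow> bool" where
  "generating G M a \<alpha> \<longleftrightarrow>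
     (\<forall>B\<in>sets M. \<exists>C\<in>sets (translates M a (carrier G) \<alpha>). (B - C) \<union> (C - B) \<in> null_sets M)"

definition markov_process_wrt ::
  "('g, 'm) monoid_scheme \<Rightarrow> 'a measure \<Rightarrow> ('g \<Rightarrow> 'a \<Rightarrow> 'a) \<Rightarrow> 'g set \<Rightarrow> 'a set set \<Rightarrow> bool" where
  "markov_process_wrt G M a S \<alpha> \<longleftrightarrow>
     pmp_action G M a \<and> countable_partition M \<alpha> \<and> generating G M a \<alpha> \<and>
     (\<forall>A\<in>\<alpha>. \<forall>s\<in>sym_gens G S. AE x in M.
        real_cond_exp M (translates M a (RPast G S \<one>\<^bsub>G\<^esub> s) \<alpha>) (indicator (a s ` A)) x =
        real_cond_exp M (sigma (space M) \<alpha>) (indicator (a s ` A)) x)"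

definition markov_process ::
  "('g, 'm) monoid_scheme \<Rightarrow> 'a measure \<Rightarrow> ('g \<Rightarrow> 'a \<Rightarrow> 'a) \<Rightarrow> bool" where
  "markov_process G M a \<longleftrightarrow>
     (\<exists>S \<alpha>. free_generating_set G S \<and> markov_process_wrt G M a S \<alpha>)"

text \<open>
  HOL cannot quantify over the type of points of the conjugate process, so that type is a
  parameter.
\<close>

definition conjugate_to_markov_process ::
  "'b itself \<Rightarrow> ('g, 'm) monoid_scheme \<Rightarrow> 'a measure \<Rightarrow> ('g \<Rightarrow> 'a \<Rightarrow> 'a) \<Rightarrow> bool" where
  "conjugate_to_markov_process TYPE('b) G M a \<longleftrightarrow>
     (\<exists>(N :: 'b measure) b. markov_process G N b \<and> measurably_conjugate G M a N b)"

end

(*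
  The Cayley graph of G is a tree, and H has a finite connected transversal D (so 1 is in D and G is
  the disjoint union of the tiles hD). Contracting every tile to a point yields a tree on which H acts
  simply transitively on vertices, so H is freely generated by the set T of those t for which a
  positively labelled edge leads from D to tD; freeness is a ping-pong argument with the half trees
  cut off by the edges that leave D. A tile is joined to each neighbour by a single edge, so the T-past
  of an edge of the quotient tree lies in one side of an edge of the original tree. For the join of
  the partitions d.alpha, d in D, the Markov property for T thus follows from the Markov property of
  alpha across that edge, which extends from the endpoint of the edge to finite connected sets beyond it.
*)
theory Submission
  imports Defs
begin

section \<open>Reduced words and half trees\<close>

text \<open>Paths are handled only where right pasts force them. Elsewhere a tree argument rests on
  one fact: an edge is the only passage between a half tree and its complement, so a connected set
  that does not contain both ends of the edge stays on one side. Right pasts enter through two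
  inclusions. For \<open>G\<close>, the past contains the complement of a half tree, so the
  hypothesis applies to sets measurable over that complement. For \<open>H\<close>, the tiles of the
  past avoid \<open>far l\<close>, so it suffices to prove the conclusion over the complement of
  \<open>far l\<close>. Conditional expectations are traded on both sides for product identities
  mu(C Int A Int Q) mu(A) = mu(C Int A) mu(A Int Q), with A an atom and Q a past set. These hold
  trivially at null atoms and can be translated, combined and cancelled like numbers. Finite index
  is used through the finiteness of \<open>D\<close>: it keeps the join of countable partitions
  countable, and a neighbouring tile can be exhausted leaf by leaf.\<close>

definition letter_inv :: "'g \<times> bool \<Rightarrow> 'g \<times> bool" where
  "letter_inv l = (fst l, \<not> snd l)"

lemma letter_inv_letter_inv [simp]: "letter_inv (letter_inv l) = l"
  by (simp add: letter_inv_def)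

lemma letter_inv_in_letters [simp]: "letter_inv l \<in> S \<times> UNIV \<longleftrightarrow> l \<in> S \<times> UNIV"
  by (cases l) (simp add: letter_inv_def)

lemma not_cancelling_iff:
  "\<not> (fst k = fst l \<and> snd k \<noteq> snd l) \<longleftrightarrow> l \<noteq> letter_inv k"
  by (cases k; cases l) (auto simp: letter_inv_def)

lemma reduced_words_Nil [simp]: "[] \<in> reduced_words S"
  by (simp add: reduced_words_def)

lemma reduced_words_Cons:
  "l # w \<in> reduced_words S \<longleftrightarrow>
     l \<in> S \<times> UNIV \<and> w \<in> reduced_words S \<and> (w \<noteq> [] \<longrightarrow> hd w \<noteq> letter_inv l)"
  unfolding reduced_words_def mem_Collect_eq not_cancelling_iff
  by (cases w) auto

lemma reduced_words_snoc:
  "w @ [l] \<in> reduced_words S \<longleftrightarrow>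
     l \<in> S \<times> UNIV \<and> w \<in> reduced_words S \<and> (w \<noteq> [] \<longrightarrow> l \<noteq> letter_inv (last w))"
  unfolding reduced_words_def mem_Collect_eq not_cancelling_iff
  by (auto simp: successively_append_iff)

lemma reduced_words_in_lists: "w \<in> reduced_words S \<Longrightarrow> w \<in> lists (S \<times> UNIV)"
  by (simp add: reduced_words_def)

text \<open>Freeness is assumed only in the extension \<open>free_generators\<close>, so that these
  facts also serve the Schreier generators before they are known to be free.\<close>

locale generating_letters = group G for G (structure) +
  fixes S :: "'a set"
  assumes generators_closed: "S \<subseteq> carrier G"
begin

lemma letter_value_closed [simp]: "l \<in> S \<times> UNIV \<Longrightarrow> letter_value G l \<in> carrier G"
  using generators_closed by (cases l) auto

lemma letter_value_letter_inv [simp]: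
  "l \<in> S \<times> UNIV \<Longrightarrow> letter_value G (letter_inv l) = inv (letter_value G l)"
  using generators_closed by (cases l) (auto simp: letter_inv_def)

lemma sym_gens_eq: "sym_gens G S = letter_value G ` (S \<times> UNIV)"
proof (intro equalityI subsetI)
  fix x assume "x \<in> sym_gens G S"
  then consider "x \<in> S" | s where "s \<in> S" "x = inv s" by (auto simp: sym_gens_def)
  then show "x \<in> letter_value G ` (S \<times> UNIV)"
    by cases (force intro: image_eqI[of _ _ "(_, True)"] image_eqI[of _ _ "(_, False)"])+
qed (auto simp: sym_gens_def)

lemma word_value_Nil [simp]: "word_value G [] = \<one>"
  by (simp add: word_value_def)

lemma word_value_Cons [simp]: "word_value G (l # w) = letter_value G l \<otimes> word_value G w"
  by (simp add: word_value_def)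

lemma word_value_closed [simp]: "w \<in> lists (S \<times> UNIV) \<Longrightarrow> word_value G w \<in> carrier G"
  by (induction w) auto

lemma reduced_word_closed [simp]: "w \<in> reduced_words S \<Longrightarrow> word_value G w \<in> carrier G"
  by (simp add: reduced_words_in_lists)

lemma word_value_append:
  "u \<in> lists (S \<times> UNIV) \<Longrightarrow> v \<in> lists (S \<times> UNIV) \<Longrightarrow>
     word_value G (u @ v) = word_value G u \<otimes> word_value G v"
  by (induction u) (auto simp: m_assoc)

lemma word_value_snoc:
  "w \<in> lists (S \<times> UNIV) \<Longrightarrow> l \<in> S \<times> UNIV \<Longrightarrow>
     word_value G (w @ [l]) = word_value G w \<otimes> letter_value G l"
  by (simp add: word_value_append)

lemma mult_letter_inv_cancel [simp]:
  "x \<in> carrier G \<Longrightarrow> l \<in> S \<times> UNIV \<Longrightarrow>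
     x \<otimes> letter_value G l \<otimes> inv (letter_value G l) = x"
  by (simp add: m_assoc)

text \<open>A letter on the right acts only on the end of the word: it is appended, or it cancels
  the last letter. This locates the entrance of a half tree and later shows that the Schreier
  generators generate.\<close>

lemma reduced_word_mult_letter:
  assumes w: "w \<in> reduced_words S" and l: "l \<in> S \<times> UNIV"
  obtains "w @ [l] \<in> reduced_words S"
  | u where "w = u @ [letter_inv l]" "u \<in> reduced_words S"
      "word_value G w \<otimes> letter_value G l = word_value G u"
proof (cases "w @ [l] \<in> reduced_words S")
  case False
  then have "w \<noteq> []" "l = letter_inv (last w)"
    using w l by (auto simp: reduced_words_snoc)
  then have eq: "w = butlast w @ [letter_inv l]" by simp
  then have red: "butlast w \<in> reduced_words S" using w by (metis reduced_words_snoc)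
  have "word_value G w \<otimes> letter_value G l =
      word_value G (butlast w) \<otimes> inv (letter_value G l) \<otimes> letter_value G l"
    using word_value_snoc[OF reduced_words_in_lists[OF red], of "letter_inv l"] red l
    by (simp flip: eq del: mem_Times_iff)
  also have "\<dots> = word_value G (butlast w)"
    using red l by (simp add: m_assoc del: mem_Times_iff)
  finally show ?thesis using that(2) eq red by blast
qed (rule that(1))

text \<open>Connectedness in the Cayley graph, phrased through cuts so that no paths are needed.\<close>

definition connected_set :: "'a set \<Rightarrow> bool" where
  "connected_set V \<longleftrightarrow>
     (\<forall>Y. V \<inter> Y \<noteq> {} \<longrightarrow>
       (\<forall>x\<in>V \<inter> Y. \<forall>l\<in>S \<times> UNIV. x \<otimes> letter_value G l \<in> V \<longrightarrow> x \<otimes> letter_value G l \<in> Y) \<longrightarrow>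
       V \<subseteq> Y)"

lemma connected_setD:
  assumes "connected_set V" "x \<in> V" "x \<in> Y"
    and "\<And>x l. x \<in> V \<Longrightarrow> x \<in> Y \<Longrightarrow> l \<in> S \<times> UNIV \<Longrightarrow>
           x \<otimes> letter_value G l \<in> V \<Longrightarrow> x \<otimes> letter_value G l \<in> Y"
  shows "V \<subseteq> Y"
  using assms unfolding connected_set_def by blast

lemma connected_set_singleton: "connected_set {x}"
  by (auto simp: connected_set_def)

lemma connected_set_insert:
  assumes V: "connected_set V" and x: "x \<in> V" "x \<in> carrier G" and l: "l \<in> S \<times> UNIV"
  shows "connected_set (insert (x \<otimes> letter_value G l) V)"
  unfolding connected_set_def
proof (intro allI impI)
  let ?y = "x \<otimes> letter_value G l"
  fix Y
  assume ne: "insert ?y V \<inter> Y \<noteq> {}"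
    and step: "\<forall>z\<in>insert ?y V \<inter> Y. \<forall>k\<in>S \<times> UNIV.
      z \<otimes> letter_value G k \<in> insert ?y V \<longrightarrow> z \<otimes> letter_value G k \<in> Y"
  \<comment> \<open>If \<open>Y\<close> contains the new vertex, the inverse letter leads back to
    \<open>x\<close>, so \<open>Y\<close> meets \<open>V\<close> in every case.\<close>
  have "V \<inter> Y \<noteq> {}"
  proof (cases "?y \<in> Y")
    case True
    then have "?y \<otimes> letter_value G (letter_inv l) \<in> Y"
      using step x l by (metis IntI insertCI letter_inv_in_letters letter_value_letter_inv
          mult_letter_inv_cancel)
    then show ?thesis using x l by auto
  qed (use ne in auto)
  then have "V \<subseteq> Y" using V step unfolding connected_set_def by blast
  then show "insert ?y V \<subseteq> Y" using step x l by blast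
qed

lemma connected_set_l_coset:
  assumes V: "connected_set V" "V \<subseteq> carrier G" and g: "g \<in> carrier G"
  shows "connected_set (g <# V)"
  unfolding connected_set_def
proof (intro allI impI)
  fix Y
  assume ne: "(g <# V) \<inter> Y \<noteq> {}"
    and step: "\<forall>x\<in>(g <# V) \<inter> Y. \<forall>l\<in>S \<times> UNIV.
      x \<otimes> letter_value G l \<in> g <# V \<longrightarrow> x \<otimes> letter_value G l \<in> Y"
  obtain x where x: "x \<in> V" "g \<otimes> x \<in> Y" using ne by (auto simp: l_coset_def)
  have "V \<subseteq> {x. g \<otimes> x \<in> Y}"
  proof (rule connected_setD[OF V(1) x(1)])
    fix z l
    assume z: "z \<in> V" "z \<in> {x. g \<otimes> x \<in> Y}" "l \<in> S \<times> UNIV" "z \<otimes> letter_value G l \<in> V"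
    have eq: "g \<otimes> (z \<otimes> letter_value G l) = g \<otimes> z \<otimes> letter_value G l"
      using z V g by (simp add: m_assoc subset_iff del: mem_Times_iff)
    have "g \<otimes> z \<in> (g <# V) \<inter> Y" "g \<otimes> z \<otimes> letter_value G l \<in> g <# V"
      using z unfolding l_coset_def eq[symmetric] by blast+
    then show "z \<otimes> letter_value G l \<in> {x. g \<otimes> x \<in> Y}"
      using step z(3) eq by auto
  qed (use x in simp)
  then show "g <# V \<subseteq> Y" by (auto simp: l_coset_def)
qed

text \<open>Dropping last letters leads from each word of \<open>W\<close> down to the common prefix
  \<open>w0\<close> without leaving \<open>W\<close>, hence along edges. The prefix is
  \<open>[]\<close> for the whole group and for complements of half trees, and \<open>[l]\<close>
  for half trees.\<close>

lemma connected_set_words: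
  assumes d: "d \<in> carrier G" and W: "W \<subseteq> lists (S \<times> UNIV)"
    and prefix: "\<And>w. w \<in> W \<Longrightarrow> \<exists>u. w = w0 @ u"
    and closed: "\<And>u l. w0 @ u @ [l] \<in> W \<Longrightarrow> w0 @ u \<in> W"
  shows "connected_set ((\<lambda>w. d \<otimes> word_value G w) ` W)"
  unfolding connected_set_def
proof (intro allI impI)
  let ?f = "\<lambda>w. d \<otimes> word_value G w"
  fix Y
  assume ne: "?f ` W \<inter> Y \<noteq> {}"
    and step: "\<forall>x\<in>?f ` W \<inter> Y. \<forall>l\<in>S \<times> UNIV.
      x \<otimes> letter_value G l \<in> ?f ` W \<longrightarrow> x \<otimes> letter_value G l \<in> Y"
  have iff: "w0 @ u \<in> W \<Longrightarrow> ?f (w0 @ u) \<in> Y \<longleftrightarrow> ?f w0 \<in> Y" for u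
  proof (induction u rule: rev_induct)
    case (snoc l u)
    have in_W: "w0 @ u \<in> W" using closed snoc.prems by blast
    have "w0 @ u @ [l] \<in> lists (S \<times> UNIV)" using snoc.prems W by blast
    then have l: "l \<in> S \<times> UNIV" and lists: "w0 @ u \<in> lists (S \<times> UNIV)" by simp_all
    have fl: "?f (w0 @ u @ [l]) = ?f (w0 @ u) \<otimes> letter_value G l"
      using word_value_snoc[OF lists l] d l lists by (simp add: m_assoc del: append_in_lists_conv)
    have fr: "?f (w0 @ u) = ?f (w0 @ u @ [l]) \<otimes> letter_value G (letter_inv l)"
      unfolding fl using d l lists by (simp del: append_in_lists_conv)
    have "?f (w0 @ u @ [l]) \<in> Y \<longleftrightarrow> ?f (w0 @ u) \<in> Y"
    proof
      assume "?f (w0 @ u @ [l]) \<in> Y"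
      then show "?f (w0 @ u) \<in> Y"
        using step snoc.prems in_W l unfolding fr by (metis IntI fr image_eqI letter_inv_in_letters)
    next
      assume "?f (w0 @ u) \<in> Y"
      then show "?f (w0 @ u @ [l]) \<in> Y"
        using step snoc.prems in_W l unfolding fl by (metis IntI fl image_eqI)
    qed
    then show ?case using snoc.IH in_W by simp
  qed simp
  then have "w \<in> W \<Longrightarrow> ?f w \<in> Y \<longleftrightarrow> ?f w0 \<in> Y" for w
    using prefix by blast
  then show "?f ` W \<subseteq> Y" using ne by blast
qed

end

section \<open>Half trees and the connected sets on one side of an edge\<close>

locale free_generators = generating_letters +
  assumes free: "free_generating_set G S"
begin

lemma word_value_inj: "inj_on (word_value G) (reduced_words S)"
  using free by (auto simp: free_generating_set_def bij_betw_def)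

lemma carrier_eq: "word_value G ` reduced_words S = carrier G"
  using free by (auto simp: free_generating_set_def bij_betw_def)

lemma connected_set_carrier: "connected_set (carrier G)"
proof -
  have "connected_set ((\<lambda>w. \<one> \<otimes> word_value G w) ` reduced_words S)"
    by (rule connected_set_words[where ?w0.0 = "[]"])
      (auto simp: reduced_words_snoc dest: reduced_words_in_lists)
  also have "(\<lambda>w. \<one> \<otimes> word_value G w) ` reduced_words S = word_value G ` reduced_words S"
    by (intro image_cong) simp_all
  finally show ?thesis by (simp add: carrier_eq)
qed

text \<open>The component without \<open>d\<close> that is left when the edge from \<open>d\<close>
  along \<open>l\<close> is removed from the Cayley tree.\<close>

definition half_tree :: "'a \<Rightarrow> 'a \<times> bool \<Rightarrow> 'a set" where
  "half_tree d l = (\<lambda>w. d \<otimes> word_value G w) ` {w \<in> reduced_words S. w \<noteq> [] \<and> hd w = l}"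

lemma half_tree_closed: "d \<in> carrier G \<Longrightarrow> half_tree d l \<subseteq> carrier G"
  by (auto simp: half_tree_def)

lemma half_tree_iff:
  assumes "d \<in> carrier G" "w \<in> reduced_words S"
  shows "d \<otimes> word_value G w \<in> half_tree d l \<longleftrightarrow> w \<noteq> [] \<and> hd w = l"
proof -
  have "d \<otimes> word_value G w = d \<otimes> word_value G u \<longleftrightarrow> w = u" if "u \<in> reduced_words S" for u
    using assms that inj_on_eq_iff[OF word_value_inj] by simp
  then show ?thesis using assms(2) unfolding half_tree_def by blast
qed

lemma obtain_word:
  assumes "d \<in> carrier G" "x \<in> carrier G"
  obtains w where "w \<in> reduced_words S" "x = d \<otimes> word_value G w"
proof -
  have "inv d \<otimes> x \<in> carrier G" using assms by simp
  then obtain w where "w \<in> reduced_words S" "inv d \<otimes> x = word_value G w"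
    unfolding carrier_eq[symmetric] by auto
  moreover then have "x = d \<otimes> word_value G w"
    using assms by (metis inv_solve_left' reduced_words_in_lists word_value_closed)
  ultimately show ?thesis using that by blast
qed

lemma source_notin_half_tree: "d \<in> carrier G \<Longrightarrow> d \<notin> half_tree d l"
  using half_tree_iff[of d "[]" l] by simp

lemma target_in_half_tree:
  "d \<in> carrier G \<Longrightarrow> l \<in> S \<times> UNIV \<Longrightarrow> d \<otimes> letter_value G l \<in> half_tree d l"
  using half_tree_iff[of d "[l]" l] by (simp add: reduced_words_Cons del: mem_Times_iff)

lemma l_coset_half_tree:
  assumes "g \<in> carrier G" "d \<in> carrier G"
  shows "g <# half_tree d l = half_tree (g \<otimes> d) l"
proof -
  have "g \<otimes> (d \<otimes> word_value G w) = g \<otimes> d \<otimes> word_value G w" if "w \<in> reduced_words S" for w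
    using assms that by (simp add: m_assoc reduced_words_in_lists)
  then show ?thesis by (auto simp: l_coset_def half_tree_def)
qed

lemma connected_half_tree:
  assumes d: "d \<in> carrier G"
  shows "connected_set (half_tree d l)"
  unfolding half_tree_def
proof (rule connected_set_words[where ?w0.0 = "[l]", OF d])
  fix w assume "w \<in> {w \<in> reduced_words S. w \<noteq> [] \<and> hd w = l}"
  then show "\<exists>u. w = [l] @ u" by (cases w) auto
next
  fix u k assume "[l] @ u @ [k] \<in> {w \<in> reduced_words S. w \<noteq> [] \<and> hd w = l}"
  then have "([l] @ u) @ [k] \<in> reduced_words S" by simp
  then show "[l] @ u \<in> {w \<in> reduced_words S. w \<noteq> [] \<and> hd w = l}"
    unfolding reduced_words_snoc by simp
qed (auto dest: reduced_words_in_lists)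

lemma connected_complement_half_tree:
  assumes d: "d \<in> carrier G"
  shows "connected_set (carrier G - half_tree d l)"
proof -
  let ?W = "{w \<in> reduced_words S. \<not> (w \<noteq> [] \<and> hd w = l)}"
  have "connected_set ((\<lambda>w. d \<otimes> word_value G w) ` ?W)"
  proof (rule connected_set_words[where ?w0.0 = "[]", OF d])
    fix u k assume "[] @ u @ [k] \<in> ?W"
    then have "u @ [k] \<in> reduced_words S" "u \<noteq> [] \<longrightarrow> hd u \<noteq> l" by auto
    then show "[] @ u \<in> ?W" unfolding reduced_words_snoc by auto
  qed (auto dest: reduced_words_in_lists)
  also have "(\<lambda>w. d \<otimes> word_value G w) ` ?W = carrier G - half_tree d l"
  proof (intro equalityI subsetI)
    fix x assume "x \<in> (\<lambda>w. d \<otimes> word_value G w) ` ?W"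
    then show "x \<in> carrier G - half_tree d l"
      using d half_tree_iff[OF d, of _ l] by auto
  next
    fix x assume x: "x \<in> carrier G - half_tree d l"
    then obtain w where "w \<in> reduced_words S" "x = d \<otimes> word_value G w"
      using obtain_word d by (metis DiffD1)
    then show "x \<in> (\<lambda>w. d \<otimes> word_value G w) ` ?W"
      using x half_tree_iff[OF d] by blast
  qed
  finally show ?thesis .
qed

text \<open>Right multiplication alters a reduced word only at its end, so the first letter can
  become \<open>l\<close> only if the word was empty, that is, at \<open>d\<close> itself.\<close>

lemma crossing_edge:
  assumes d: "d \<in> carrier G" and x: "x \<in> carrier G" and k: "k \<in> S \<times> UNIV"
    and out: "x \<notin> half_tree d l" and into: "x \<otimes> letter_value G k \<in> half_tree d l"
  shows "x = d \<and> k = l"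
proof -
  obtain w where w: "w \<in> reduced_words S" "x = d \<otimes> word_value G w"
    using obtain_word[OF d x] by blast
  have not_hd: "\<not> (w \<noteq> [] \<and> hd w = l)" using out half_tree_iff[OF d w(1)] w(2) by blast
  have xk: "x \<otimes> letter_value G k = d \<otimes> (word_value G w \<otimes> letter_value G k)"
    using d w k by (simp add: m_assoc reduced_words_in_lists)
  show ?thesis
  proof (cases rule: reduced_word_mult_letter[OF w(1) k])
    case 1
    have "x \<otimes> letter_value G k = d \<otimes> word_value G (w @ [k])"
      using xk w k by (simp add: word_value_snoc reduced_words_in_lists)
    then have "hd (w @ [k]) = l" using into half_tree_iff[OF d 1] by simp
    then have "w = [] \<and> k = l" using not_hd by (cases "w = []") auto
    then show ?thesis using w d by simp
  next
    case (2 u)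
    then have "u \<noteq> [] \<and> hd u = l" using into half_tree_iff[OF d 2(2)] xk by simp
    then show ?thesis using not_hd 2 by simp
  qed
qed

lemma leaving_edge:
  assumes d: "d \<in> carrier G" and x: "x \<in> half_tree d l" and k: "k \<in> S \<times> UNIV"
    and out: "x \<otimes> letter_value G k \<notin> half_tree d l"
  shows "x \<otimes> letter_value G k = d"
proof -
  have xc: "x \<in> carrier G" using half_tree_closed[OF d] x by blast
  then have "x \<otimes> letter_value G k \<otimes> letter_value G (letter_inv k) \<in> half_tree d l"
    using x k by simp
  then show ?thesis
    using crossing_edge[OF d _ _ out, of "letter_inv k"] xc k by simp
qed

text \<open>Entering the half tree within \<open>V\<close> would use its single entrance, whose ends
  do not both lie in \<open>V\<close>. This lemma and the next take the place of arguments about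
  paths.\<close>

lemma connected_set_disjnt_half_tree:
  assumes V: "connected_set V" "V \<subseteq> carrier G" and d: "d \<in> carrier G"
    and x: "x \<in> V" "x \<notin> half_tree d l"
    and edge: "\<not> (d \<in> V \<and> d \<otimes> letter_value G l \<in> V)"
  shows "V \<inter> half_tree d l = {}"
proof -
  have "V \<subseteq> - half_tree d l"
  proof (rule connected_setD[OF V(1) x(1)])
    fix z k assume z: "z \<in> V" "z \<in> - half_tree d l" "k \<in> S \<times> UNIV" "z \<otimes> letter_value G k \<in> V"
    show "z \<otimes> letter_value G k \<in> - half_tree d l"
      using crossing_edge[OF d, of z k l] z V edge by blast
  qed (use x in simp)
  then show ?thesis by blast
qed

lemma connected_set_subset_half_tree:
  assumes V: "connected_set V" and d: "d \<in> carrier G"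
    and x: "x \<in> V" "x \<in> half_tree d l" and "d \<notin> V"
  shows "V \<subseteq> half_tree d l"
proof (rule connected_setD[OF V x])
  fix z k assume z: "z \<in> V" "z \<in> half_tree d l" "k \<in> S \<times> UNIV" "z \<otimes> letter_value G k \<in> V"
  show "z \<otimes> letter_value G k \<in> half_tree d l"
    using leaving_edge[OF d z(2,3)] z(4) \<open>d \<notin> V\<close> by auto
qed

text \<open>The prefixes of the reduced word of \<open>g\<close> form a simple path from \<open>g\<close> to \<open>\<one>\<close>.\<close>

lemma complement_half_tree_subset_RPast:
  assumes l: "l \<in> S \<times> UNIV"
  shows "carrier G - half_tree \<one> l \<subseteq> RPast G S \<one> (letter_value G l)"
proof -
  \<comment> \<open>The length bound makes each added vertex new, hence the path simple. The
    condition on first letters keeps the path away from \<open>letter_value G l\<close>, the value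
    of the word \<open>[l]\<close>.\<close>
  define B where "B w = {u \<in> reduced_words S. length u \<le> length w \<and> (u \<noteq> [] \<longrightarrow> hd u = hd w)}"
    for w
  have path: "\<exists>p. simple_path G S (word_value G w) \<one> p \<and> set p \<subseteq> word_value G ` B w"
    if "w \<in> reduced_words S" for w
    using that
  proof (induction w rule: rev_induct)
    case Nil
    have "simple_path G S (word_value G []) \<one> [\<one>]" by (simp add: simple_path_def)
    moreover have "\<one> \<in> word_value G ` B []" by (rule image_eqI[of _ _ "[]"]) (auto simp: B_def)
    ultimately show ?case by (intro exI[of _ "[\<one>]"]) simp
  next
    case (snoc k w)
    have w: "w \<in> reduced_words S" "k \<in> S \<times> UNIV" using snoc.prems by (simp_all add: reduced_words_snoc)
    obtain p where p: "simple_path G S (word_value G w) \<one> p" "set p \<subseteq> word_value G ` B w"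
      using snoc.IH[OF w(1)] by blast
    have sub: "B w \<subseteq> B (w @ [k])" by (cases "w = []") (auto simp: B_def)
    have new: "word_value G (w @ [k]) \<notin> set p"
    proof
      assume "word_value G (w @ [k]) \<in> set p"
      then obtain u where u: "u \<in> B w" "word_value G u = word_value G (w @ [k])" using p by force
      then have "u = w @ [k]"
        using inj_on_eq_iff[OF word_value_inj] snoc.prems by (simp add: B_def)
      then show False using u by (simp add: B_def)
    qed
    have "word_value G w = word_value G (w @ [k]) \<otimes> letter_value G (letter_inv k)"
      using w by (simp add: word_value_snoc reduced_words_in_lists del: mem_Times_iff)
    then have edge: "cayley_edge G S (word_value G (w @ [k])) (word_value G w)"
      unfolding cayley_edge_def sym_gens_eq
      using reduced_word_closed[OF snoc.prems] w(2) letter_inv_in_letters by blast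
    have "simple_path G S (word_value G (w @ [k])) \<one> (word_value G (w @ [k]) # p)"
      using p(1) new edge by (cases p) (auto simp: simple_path_def)
    moreover have "w @ [k] \<in> B (w @ [k])" using snoc.prems by (simp add: B_def)
    then have "set (word_value G (w @ [k]) # p) \<subseteq> word_value G ` B (w @ [k])"
      using p(2) sub by (simp del: word_value_Cons) blast
    ultimately show ?case by blast
  qed
  show ?thesis
  proof
    fix g assume g: "g \<in> carrier G - half_tree \<one> l"
    then obtain w where w: "w \<in> reduced_words S" "g = word_value G w"
      using carrier_eq by auto
    then have nothd: "\<not> (w \<noteq> [] \<and> hd w = l)"
      using half_tree_iff[of \<one> w l] g reduced_words_in_lists by auto
    obtain p where p: "simple_path G S g \<one> p"
      "set p \<subseteq> word_value G ` B w"
      using path[OF w(1)] w(2) by blast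
    have "letter_value G l \<notin> set p"
    proof
      assume "letter_value G l \<in> set p"
      then obtain u where u: "u \<in> reduced_words S" "length u \<le> length w" "u \<noteq> [] \<longrightarrow> hd u = hd w"
        "word_value G u = letter_value G l"
        using p(2) by (force simp: B_def)
      then have "word_value G u = word_value G [l]" using l by simp
      moreover have "[l] \<in> reduced_words S" using l by (simp add: reduced_words_Cons)
      ultimately have "u = [l]" using inj_on_eq_iff[OF word_value_inj] u(1) by blast
      then show False using u nothd by auto
    qed
    moreover have "cayley_edge G S \<one> (letter_value G l)"
      unfolding cayley_edge_def sym_gens_eq
      using l l_one[OF letter_value_closed[OF l], symmetric] one_closed by blast
    moreover have "p \<noteq> []" "hd p = g" "last p = \<one>" "distinct p" "successively (cayley_edge G S) p"
      using p(1) unfolding simple_path_def by simp_all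
    ultimately have "simple_path G S g (letter_value G l) (p @ [letter_value G l])"
      unfolding simple_path_def successively_append_iff by simp
    moreover have "\<one> \<in> set p"
      using last_in_set[OF \<open>p \<noteq> []\<close>] \<open>last p = \<one>\<close> by simp
    ultimately show "g \<in> RPast G S \<one> (letter_value G l)"
      using g by (auto simp: RPast_def)
  qed
qed

end

section \<open>Schreier transversals\<close>

locale schreier_transversal = free_generators +
  fixes H D :: "'a set"
  assumes subgroup_H: "subgroup H G"
    and D_closed: "D \<subseteq> carrier G" and finite_D: "finite D" and one_in_D: "\<one> \<in> D"
    and connected_D: "connected_set D"
    and tiles_cover: "g \<in> carrier G \<Longrightarrow> \<exists>h\<in>H. g \<in> h <# D"
    and tiles_disjoint: "h \<in> H \<Longrightarrow> h' \<in> H \<Longrightarrow> x \<in> h <# D \<Longrightarrow> x \<in> h' <# D \<Longrightarrow> h = h'"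

text \<open>\<open>D\<close> is a largest connected set through \<open>\<one>\<close> with at most
  one point in each right coset of \<open>H\<close>; the index bounds its size. If its tiles did not
  cover the tree, some edge would lead out of their union, and the translate of this edge that
  starts in \<open>D\<close> would supply a point to add.\<close>

lemma (in free_generators) schreier_transversal_exists:
  assumes H: "subgroup H G" and fin: "finite (rcosets H)"
  shows "\<exists>D. schreier_transversal G S H D"
proof -
  define good where "good D \<longleftrightarrow> D \<subseteq> carrier G \<and> finite D \<and> \<one> \<in> D \<and> connected_set D \<and>
      inj_on (\<lambda>x. H #> x) D" for D
  have Hc: "H \<subseteq> carrier G" using H by (rule subgroup.subset)
  have "card D < Suc (card (rcosets H))" if "good D" for D
  proof -
    have "(\<lambda>x. H #> x) ` D \<subseteq> rcosets H"
      using that unfolding good_def RCOSETS_def by blast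
    then have "card D \<le> card (rcosets H)"
      using card_inj_on_le[OF _ _ fin] that unfolding good_def by blast
    then show ?thesis by simp
  qed
  moreover have "good {\<one>}" by (simp add: good_def connected_set_singleton)
  ultimately obtain D where good: "good D" and max: "\<And>E. good E \<Longrightarrow> card E \<le> card D"
    using ex_has_greatest_nat[of good "{\<one>}" card "Suc (card (rcosets H))"] by blast
  have D: "D \<subseteq> carrier G" "finite D" "\<one> \<in> D" "connected_set D" "inj_on (\<lambda>x. H #> x) D"
    using good unfolding good_def by auto
  have "carrier G \<subseteq> {x. \<exists>d\<in>D. x \<in> H #> d}"
  proof (rule connected_setD[OF connected_set_carrier one_closed])
    show "\<one> \<in> {x. \<exists>d\<in>D. x \<in> H #> d}" using D(3) H subgroup.one_closed[OF H] rcos_self by blast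
  next
    fix x and l :: "'a \<times> bool"
    assume x: "x \<in> carrier G" "x \<in> {x. \<exists>d\<in>D. x \<in> H #> d}" and l: "l \<in> S \<times> UNIV"
    then obtain d h where dh: "d \<in> D" "h \<in> H" "x = h \<otimes> d" by (auto simp: r_coset_def)
    have dc: "d \<in> carrier G" "h \<in> carrier G" using D dh Hc by auto
    show "x \<otimes> letter_value G l \<in> {x. \<exists>d\<in>D. x \<in> H #> d}"
    proof (rule ccontr)
      let ?y = "d \<otimes> letter_value G l"
      assume "x \<otimes> letter_value G l \<notin> {x. \<exists>d\<in>D. x \<in> H #> d}"
      moreover have "x \<otimes> letter_value G l = h \<otimes> ?y"
        using dh dc l by (simp add: m_assoc del: mem_Times_iff)
      moreover have "h \<otimes> ?y \<in> H #> e" if "?y \<in> H #> e" "e \<in> D" for e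
      proof -
        obtain h' where h': "h' \<in> H" "?y = h' \<otimes> e" using \<open>?y \<in> H #> e\<close> by (auto simp: r_coset_def)
        have "h \<otimes> ?y = (h \<otimes> h') \<otimes> e"
          unfolding h'(2) using h'(1) that(2) D(1) Hc dc by (simp add: m_assoc subset_iff)
        moreover have "h \<otimes> h' \<in> H" using subgroup.m_closed[OF H] dh h' by blast
        ultimately show ?thesis by (auto simp: r_coset_def)
      qed
      ultimately have new: "\<And>e. e \<in> D \<Longrightarrow> ?y \<notin> H #> e" by auto
      have yc: "?y \<in> carrier G" using dc l by (simp del: mem_Times_iff)
      have self: "?y \<in> H #> ?y" using rcos_self[OF yc H] .
      have "good (insert ?y D)"
        unfolding good_def inj_on_insert
        using D yc connected_set_insert[OF D(4) dh(1) dc(1) l] new self by auto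
      moreover have "?y \<notin> D" using new rcos_self[OF yc H] by blast
      ultimately show False using max[of "insert ?y D"] D(2) by simp
    qed
  qed
  then have cover: "\<exists>h\<in>H. g \<in> h <# D" if "g \<in> carrier G" for g
    using that by (fastforce simp: r_coset_def l_coset_def)
  have disj: "h = h'" if hh: "h \<in> H" "h' \<in> H" "x \<in> h <# D" "x \<in> h' <# D" for h h' x
  proof -
    obtain d d' where d: "d \<in> D" "d' \<in> D" "x = h \<otimes> d" "x = h' \<otimes> d'"
      using hh by (auto simp: l_coset_def)
    have c: "d \<in> carrier G" "d' \<in> carrier G" "h \<in> carrier G" "h' \<in> carrier G"
      using d hh D(1) Hc by auto
    have "x \<in> H #> d" unfolding d(3) using hh(1) by (auto simp: r_coset_def)
    moreover have "x \<in> H #> d'" unfolding d(4) using hh(2) by (auto simp: r_coset_def)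
    ultimately have "H #> d = H #> d'" using repr_independence c H by metis
    then have "d = d'" using D(5) d by (auto simp: inj_on_def)
    then show ?thesis using d(3,4) c by (metis right_cancel)
  qed
  have "schreier_transversal G S H D"
    by (intro schreier_transversal.intro schreier_transversal_axioms.intro free_generators_axioms)
      (fact H D cover disj)+
  then show ?thesis ..
qed

section \<open>Schreier generators: edges between tiles, ping-pong and freeness\<close>

context schreier_transversal
begin

lemma H_closed: "H \<subseteq> carrier G"
  using subgroup_H by (rule subgroup.subset)

lemma one_in_H: "\<one> \<in> H"
  using subgroup_H by (rule subgroup.one_closed)

lemma one_l_coset_D: "\<one> <# D = D"
  using D_closed by (force simp: l_coset_def)

lemma tile_closed: "h \<in> H \<Longrightarrow> h <# D \<subseteq> carrier G"
  using l_coset_subset_G D_closed H_closed by blast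

lemma connected_tile: "h \<in> H \<Longrightarrow> connected_set (h <# D)"
  using connected_set_l_coset connected_D D_closed H_closed by blast

lemma tile_tile: "h \<in> carrier G \<Longrightarrow> h' \<in> carrier G \<Longrightarrow> h <# (h' <# D) = (h \<otimes> h') <# D"
  by (rule lcos_m_assoc[OF D_closed])

definition schreier_gens :: "'a set" where
  "schreier_gens = {t \<in> H. t \<noteq> \<one> \<and> (\<exists>d\<in>D. \<exists>s\<in>S. d \<otimes> s \<in> t <# D)}"

lemma schreier_gens_subset: "schreier_gens \<subseteq> H"
  by (auto simp: schreier_gens_def)

sublocale T: generating_letters G schreier_gens
  by unfold_locales (use schreier_gens_subset H_closed in blast)

lemma letter_value_in_H: "l \<in> schreier_gens \<times> UNIV \<Longrightarrow> letter_value G l \<in> H"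
  using schreier_gens_subset subgroup.m_inv_closed[OF subgroup_H] by (cases l) auto

lemma letter_value_schreier_neq_one: "l \<in> schreier_gens \<times> UNIV \<Longrightarrow> letter_value G l \<noteq> \<one>"
  using H_closed by (cases l) (auto simp: schreier_gens_def inv_eq_one_eq subset_iff)

text \<open>An edge \<open>d \<midarrow> d k\<close> leaving the tile \<open>D\<close> for the tile \<open>t D\<close>, reversed and translated
  by \<open>t\<inverse>\<close>, is an edge leaving \<open>D\<close> for \<open>t\<inverse> D\<close>.\<close>

lemma reverse_edge:
  assumes t: "t \<in> H" and d: "d \<in> D" and k: "k \<in> S \<times> UNIV"
    and target: "d \<otimes> letter_value G k \<in> t <# D"
  shows "\<exists>d'\<in>D. d' \<otimes> letter_value G (letter_inv k) \<in> inv t <# D"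
proof -
  obtain d' where d': "d' \<in> D" "d \<otimes> letter_value G k = t \<otimes> d'"
    using target by (auto simp: l_coset_def)
  have c: "t \<in> carrier G" "d \<in> carrier G" "d' \<in> carrier G" using t d d'(1) H_closed D_closed by auto
  have "d' = inv t \<otimes> (d \<otimes> letter_value G k)"
    using d'(2) c by (simp add: m_assoc[symmetric])
  then have "d' \<otimes> letter_value G (letter_inv k) = inv t \<otimes> d"
    using c k by (simp add: m_assoc del: mem_Times_iff)
  then show ?thesis using d d'(1) by (auto simp: l_coset_def)
qed

lemma exists_exit:
  assumes l: "l \<in> schreier_gens \<times> UNIV"
  shows "\<exists>d k. d \<in> D \<and> k \<in> S \<times> UNIV \<and> snd k = snd l \<and> d \<otimes> letter_value G k \<in> letter_value G l <# D"
proof -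
  obtain t b where tb: "l = (t, b)" "t \<in> schreier_gens" using l by auto
  then obtain d s where ds: "d \<in> D" "s \<in> S" "d \<otimes> s \<in> t <# D" and t: "t \<in> H"
    by (auto simp: schreier_gens_def)
  show ?thesis
  proof (cases b)
    case True
    then show ?thesis using tb ds by (intro exI[of _ d] exI[of _ "(s, True)"]) simp
  next
    case False
    obtain d' where "d' \<in> D" "d' \<otimes> letter_value G (letter_inv (s, True)) \<in> inv t <# D"
      using reverse_edge[OF t ds(1), of "(s, True)"] ds by auto
    then show ?thesis using False tb ds
      by (intro exI[of _ d'] exI[of _ "(s, False)"]) (simp add: letter_inv_def)
  qed
qed

text \<open>This is the step for generation: a tile next to \<open>D\<close> is reached by one
  letter, whose sign is that of the edge.\<close>

lemma exists_letter:
  assumes h: "h \<in> H" "h \<noteq> \<one>" and d: "d \<in> D" and k: "k \<in> S \<times> UNIV"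
    and target: "d \<otimes> letter_value G k \<in> h <# D"
  shows "\<exists>l\<in>schreier_gens \<times> UNIV. letter_value G l = h"
proof -
  obtain s b where k_eq: "k = (s, b)" "s \<in> S" using k by auto
  show ?thesis
  proof (cases b)
    case True
    then have "h \<in> schreier_gens" using h d target k_eq by (auto simp: schreier_gens_def)
    then show ?thesis by (intro bexI[of _ "(h, True)"]) auto
  next
    case False
    have hc: "h \<in> carrier G" using h H_closed by blast
    obtain d' where "d' \<in> D" "d' \<otimes> letter_value G (letter_inv k) \<in> inv h <# D"
      using reverse_edge[OF h(1) d k target] by blast
    then have "inv h \<in> schreier_gens"
      using h hc k_eq False subgroup.m_inv_closed[OF subgroup_H]
      by (auto simp: schreier_gens_def letter_inv_def inv_eq_one_eq)
    then show ?thesis using hc by (intro bexI[of _ "(inv h, False)"]) auto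
  qed
qed

text \<open>The sign of the chosen edge is tied to that of \<open>l\<close>. Letters
  \<open>(t, True)\<close> and \<open>(t', False)\<close> with the same value would thus have
  different exits into the same tile, against \<open>far_disjnt_far\<close> and
  \<open>tile_subset_far\<close>. In this way the ping-pong argument also keeps generators apart
  from inverses of generators.\<close>

definition exit :: "'a \<times> bool \<Rightarrow> 'a \<times> ('a \<times> bool)" where
  "exit l = (SOME e. fst e \<in> D \<and> snd e \<in> S \<times> UNIV \<and> snd (snd e) = snd l \<and>
     fst e \<otimes> letter_value G (snd e) \<in> letter_value G l <# D)"

text \<open>The side of the exit edge away from \<open>D\<close>; these are the sets on which
  ping-pong is played.\<close>

definition far :: "'a \<times> bool \<Rightarrow> 'a set" where
  "far l = half_tree (fst (exit l)) (snd (exit l))"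

lemma exit:
  assumes "l \<in> schreier_gens \<times> UNIV"
  shows "fst (exit l) \<in> D" "fst (exit l) \<in> carrier G" "snd (exit l) \<in> S \<times> UNIV"
    "snd (snd (exit l)) = snd l"
    "fst (exit l) \<otimes> letter_value G (snd (exit l)) \<in> letter_value G l <# D"
proof -
  have "fst (exit l) \<in> D \<and> snd (exit l) \<in> S \<times> UNIV \<and> snd (snd (exit l)) = snd l \<and>
     fst (exit l) \<otimes> letter_value G (snd (exit l)) \<in> letter_value G l <# D"
    unfolding exit_def by (rule someI_ex) (use exists_exit[OF assms] in force)
  then show "fst (exit l) \<in> D" "fst (exit l) \<in> carrier G" "snd (exit l) \<in> S \<times> UNIV"
    "snd (snd (exit l)) = snd l"
    "fst (exit l) \<otimes> letter_value G (snd (exit l)) \<in> letter_value G l <# D"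
    using D_closed by auto
qed

text \<open>The far end of the exit edge belongs to the tile of \<open>letter_value G l\<close>. Any
  other tile misses that end and, being connected, cannot cross the edge.\<close>

lemma tile_disjnt_far:
  assumes l: "l \<in> schreier_gens \<times> UNIV" and h: "h \<in> H" "h \<noteq> letter_value G l"
    and x: "x \<in> h <# D" "x \<notin> far l"
  shows "(h <# D) \<inter> far l = {}"
  unfolding far_def
proof (rule connected_set_disjnt_half_tree[OF connected_tile[OF h(1)] tile_closed[OF h(1)] exit(2)[OF l] x(1)])
  show "\<not> (fst (exit l) \<in> h <# D \<and> fst (exit l) \<otimes> letter_value G (snd (exit l)) \<in> h <# D)"
    using tiles_disjoint[OF h(1) letter_value_in_H[OF l]] exit(5)[OF l] h(2) by blast
qed (use x in \<open>simp add: far_def\<close>)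

lemma D_disjnt_far:
  assumes l: "l \<in> schreier_gens \<times> UNIV"
  shows "D \<inter> far l = {}"
  using tile_disjnt_far[OF l one_in_H, of "fst (exit l)"] letter_value_schreier_neq_one[OF l]
    exit(1,2)[OF l] source_notin_half_tree[of "fst (exit l)" "snd (exit l)"]
  unfolding one_l_coset_D far_def by metis

lemma tile_subset_far:
  assumes l: "l \<in> schreier_gens \<times> UNIV"
  shows "letter_value G l <# D \<subseteq> far l"
  unfolding far_def
proof (rule connected_set_subset_half_tree[OF connected_tile[OF letter_value_in_H[OF l]]
      exit(2)[OF l] exit(5)[OF l] target_in_half_tree[OF exit(2)[OF l] exit(3)[OF l]]])
  show "fst (exit l) \<notin> letter_value G l <# D"
    using tiles_disjoint[OF one_in_H letter_value_in_H[OF l]] exit(1)[OF l]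
      letter_value_schreier_neq_one[OF l] unfolding one_l_coset_D by metis
qed

text \<open>Equal exits end in the same tile, which determines the value of the letter; the exit
  letter also records the sign.\<close>

lemma exit_inj:
  assumes l: "l \<in> schreier_gens \<times> UNIV" and l': "l' \<in> schreier_gens \<times> UNIV"
    and eq: "exit l = exit l'"
  shows "l = l'"
proof -
  have "letter_value G l = letter_value G l'"
    using tiles_disjoint[OF letter_value_in_H[OF l] letter_value_in_H[OF l']] exit(5)[OF l]
      exit(5)[OF l'] eq by simp
  moreover have "snd l = snd l'" using exit(4)[OF l] exit(4)[OF l'] eq by simp
  moreover have "fst l \<in> carrier G" "fst l' \<in> carrier G"
    using l l' schreier_gens_subset H_closed by auto
  ultimately show ?thesis by (cases l; cases l') (auto split: if_splits)
qed

text \<open>Distinct letters have distinct exits, both starting in \<open>D\<close>, outside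
  \<open>far l'\<close>. The exit of \<open>l\<close> is not the entrance of \<open>far l'\<close>,
  so its target is outside \<open>far l'\<close> too. From there \<open>far l\<close> cannot enter
  \<open>far l'\<close>, because the source of that entrance lies in \<open>D\<close>, outside
  \<open>far l\<close>.\<close>

lemma far_disjnt_far:
  assumes l: "l \<in> schreier_gens \<times> UNIV" and l': "l' \<in> schreier_gens \<times> UNIV" and "l \<noteq> l'"
  shows "far l \<inter> far l' = {}"
proof -
  let ?d = "fst (exit l)" and ?k = "snd (exit l)"
  have "far l \<inter> half_tree (fst (exit l')) (snd (exit l')) = {}"
  proof (rule connected_set_disjnt_half_tree[where x = "?d \<otimes> letter_value G ?k"])
    show "connected_set (far l)" unfolding far_def by (rule connected_half_tree[OF exit(2)[OF l]])
    show "far l \<subseteq> carrier G" unfolding far_def by (rule half_tree_closed[OF exit(2)[OF l]])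
    show "?d \<otimes> letter_value G ?k \<in> far l"
      unfolding far_def by (rule target_in_half_tree[OF exit(2)[OF l] exit(3)[OF l]])
    show "?d \<otimes> letter_value G ?k \<notin> half_tree (fst (exit l')) (snd (exit l'))"
    proof
      assume into: "?d \<otimes> letter_value G ?k \<in> half_tree (fst (exit l')) (snd (exit l'))"
      have "?d \<notin> half_tree (fst (exit l')) (snd (exit l'))"
        using D_disjnt_far[OF l'] exit(1)[OF l] unfolding far_def by blast
      then have "exit l = exit l'"
        using crossing_edge[OF exit(2)[OF l'] exit(2)[OF l] exit(3)[OF l] _ into]
        by (simp add: prod_eq_iff)
      then show False using exit_inj[OF l l'] \<open>l \<noteq> l'\<close> by blast
    qed
    show "\<not> (fst (exit l') \<in> far l \<and> fst (exit l') \<otimes> letter_value G (snd (exit l')) \<in> far l)"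
      using D_disjnt_far[OF l] exit(1)[OF l'] by blast
  qed (rule exit(2)[OF l'])
  then show ?thesis unfolding far_def[of l'] .
qed

text \<open>The ping-pong step. The only way out of \<open>far l\<close> leads to the source of
  \<open>exit l\<close>, a point of \<open>D\<close>. If the translate of \<open>far l'\<close>
  contained it, then \<open>far l'\<close> would meet the tile of \<open>letter_inv l\<close>, which
  lies in the disjoint set \<open>far (letter_inv l)\<close>.\<close>

lemma l_coset_far_subset:
  assumes l: "l \<in> schreier_gens \<times> UNIV" and l': "l' \<in> schreier_gens \<times> UNIV"
    and "l' \<noteq> letter_inv l"
  shows "letter_value G l <# far l' \<subseteq> far l"
proof -
  let ?v = "letter_value G l"
  let ?d = "fst (exit l')" and ?k = "snd (exit l')"
  have v: "?v \<in> carrier G" using T.letter_value_closed[OF l] .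
  have vd: "?v \<otimes> ?d \<in> carrier G" using v exit(2)[OF l'] by blast
  have eq: "?v <# far l' = half_tree (?v \<otimes> ?d) ?k"
    unfolding far_def by (rule l_coset_half_tree[OF v exit(2)[OF l']])
  have source: "fst (exit l) \<notin> ?v <# far l'"
  proof
    assume "fst (exit l) \<in> ?v <# far l'"
    then obtain y where y: "y \<in> far l'" "fst (exit l) = ?v \<otimes> y" by (auto simp: l_coset_def)
    have "y \<in> carrier G" using y(1) half_tree_closed[OF exit(2)[OF l']] unfolding far_def by blast
    then have "y = inv ?v \<otimes> fst (exit l)" using y(2) v by (simp add: m_assoc[symmetric])
    then have "y \<in> letter_value G (letter_inv l) <# D"
      unfolding T.letter_value_letter_inv[OF l] using exit(1)[OF l] by (auto simp: l_coset_def)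
    moreover have l2: "letter_inv l \<in> schreier_gens \<times> UNIV" using l by (simp only: letter_inv_in_letters)
    ultimately have "y \<in> far (letter_inv l)" using subsetD[OF tile_subset_far[OF l2]] by simp
    then show False using far_disjnt_far[OF l' l2 \<open>l' \<noteq> letter_inv l\<close>] y(1) by blast
  qed
  have vd_far: "?v \<otimes> ?d \<in> far l"
    using tile_subset_far[OF l] exit(1)[OF l'] by (auto simp: l_coset_def)
  have target: "?v \<otimes> ?d \<otimes> letter_value G ?k \<in> half_tree (?v \<otimes> ?d) ?k"
    by (rule target_in_half_tree[OF vd exit(3)[OF l']])
  have "half_tree (?v \<otimes> ?d) ?k \<subseteq> half_tree (fst (exit l)) (snd (exit l))"
  proof (rule connected_set_subset_half_tree[OF connected_half_tree[OF vd] exit(2)[OF l] target])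
    \<comment> \<open>The edge starts in \<open>far l\<close>. If it left \<open>far l\<close>, it
      would end at the source of \<open>exit l\<close>, which \<open>source\<close> keeps out of the
      translated half tree.\<close>
    show "?v \<otimes> ?d \<otimes> letter_value G ?k \<in> half_tree (fst (exit l)) (snd (exit l))"
      using leaving_edge[OF exit(2)[OF l] vd_far[unfolded far_def] exit(3)[OF l']] target
        source[unfolded eq] by metis
  qed (use source in \<open>simp add: eq\<close>)
  then show ?thesis unfolding eq unfolding far_def .
qed

lemma reduced_word_tile_subset_far:
  assumes "l # w \<in> reduced_words schreier_gens"
  shows "word_value G (l # w) <# D \<subseteq> far l"
  using assms
proof (induction w arbitrary: l)
  case Nil
  then have l: "l \<in> schreier_gens \<times> UNIV" by (simp add: reduced_words_Cons)
  then show ?case using tile_subset_far[OF l] T.letter_value_closed[OF l] by simp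
next
  case (Cons l' w)
  then have l: "l \<in> schreier_gens \<times> UNIV" and l': "l' \<in> schreier_gens \<times> UNIV"
    and red: "l' # w \<in> reduced_words schreier_gens" and "l' \<noteq> letter_inv l"
    by (simp_all add: reduced_words_Cons)
  have "word_value G (l # l' # w) <# D = letter_value G l <# (word_value G (l' # w) <# D)"
    using tile_tile[OF T.letter_value_closed[OF l] T.reduced_word_closed[OF red]] by simp
  also have "\<dots> \<subseteq> letter_value G l <# far l'"
    using Cons.IH[OF red] by (auto simp: l_coset_def)
  also have "\<dots> \<subseteq> far l" using l_coset_far_subset[OF l l' \<open>l' \<noteq> letter_inv l\<close>] .
  finally show ?case .
qed

text \<open>The first letter is read off from the set \<open>far l\<close> that contains the value,
  since these sets are disjoint; the empty word is told apart because \<open>D\<close> lies outside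
  all of them.\<close>

lemma schreier_word_value_inj: "inj_on (word_value G) (reduced_words schreier_gens)"
proof (rule inj_onI)
  have value_neq_one: "word_value G (l # w) \<noteq> \<one>"
    if red: "l # w \<in> reduced_words schreier_gens" for l :: "'a \<times> bool" and w
  proof
    assume "word_value G (l # w) = \<one>"
    then have "D \<subseteq> far l" using reduced_word_tile_subset_far[OF red] one_l_coset_D by simp
    moreover have "l \<in> schreier_gens \<times> UNIV" using red by (simp add: reduced_words_Cons)
    ultimately show False using D_disjnt_far one_in_D by blast
  qed
  fix u v
  assume "u \<in> reduced_words schreier_gens" "v \<in> reduced_words schreier_gens"
    "word_value G u = word_value G v"
  then show "u = v"
  proof (induction u arbitrary: v)
    case Nil
    then show ?case using value_neq_one by (cases v) (metis T.word_value_Nil)+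
  next
    case (Cons l u)
    then obtain l' v' where v: "v = l' # v'"
      using value_neq_one[OF Cons.prems(1)] by (cases v) auto
    have l: "l \<in> schreier_gens \<times> UNIV" "u \<in> reduced_words schreier_gens"
      and l': "l' \<in> schreier_gens \<times> UNIV" "v' \<in> reduced_words schreier_gens"
      using Cons.prems v by (simp_all add: reduced_words_Cons)
    \<comment> \<open>The factor \<open>\<one>\<close>, a point of \<open>D\<close>, exhibits the
      value as a point of its own tile.\<close>
    have "word_value G (l # u) \<otimes> \<one> \<in> far l \<inter> far l'"
      using reduced_word_tile_subset_far[OF Cons.prems(1)] Cons.prems(3)
        reduced_word_tile_subset_far[OF Cons.prems(2)[unfolded v]] one_in_D v
      unfolding l_coset_def by auto
    then have "l = l'" using far_disjnt_far[OF l(1) l'(1)] by blast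
    moreover have "word_value G u = word_value G v'"
      using Cons.prems(3) v \<open>l = l'\<close> l l' by (simp del: mem_Times_iff)
    then have "u = v'" using Cons.IH l l' by blast
    ultimately show ?case using v by simp
  qed
qed

lemma word_value_in_H: "w \<in> lists (schreier_gens \<times> UNIV) \<Longrightarrow> word_value G w \<in> H"
  by (induction w) (simp_all add: one_in_H subgroup.m_closed[OF subgroup_H] letter_value_in_H
      del: mem_Times_iff)

text \<open>The union of the tiles of reduced words is closed under edges: an edge starting in the
  tile of \<open>w\<close> stays there or ends in the tile of \<open>w\<close> times a letter, and
  this product is again the value of a reduced word. These tiles therefore cover the tree, and
  disjointness of tiles identifies each element of \<open>H\<close> with such a value.\<close>

lemma schreier_word_value_surj: "word_value G ` reduced_words schreier_gens = H"
proof
  show "word_value G ` reduced_words schreier_gens \<subseteq> H"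
    using word_value_in_H reduced_words_in_lists by blast
next
  let ?U = "{x. \<exists>w\<in>reduced_words schreier_gens. x \<in> word_value G w <# D}"
  have "carrier G \<subseteq> ?U"
  proof (rule connected_setD[OF connected_set_carrier one_closed])
    show "\<one> \<in> ?U" using one_in_D one_l_coset_D by (auto intro!: bexI[of _ "[]"])
  next
    fix x and l :: "'a \<times> bool"
    assume "x \<in> ?U" and l: "l \<in> S \<times> UNIV"
    then obtain w d where w: "w \<in> reduced_words schreier_gens" "d \<in> D" "x = word_value G w \<otimes> d"
      by (auto simp: l_coset_def)
    have dc: "d \<in> carrier G" using w(2) D_closed by blast
    have wc: "word_value G w \<in> carrier G" using T.reduced_word_closed[OF w(1)] .
    have lc: "letter_value G l \<in> carrier G" using l by (rule letter_value_closed)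
    have "d \<otimes> letter_value G l \<in> carrier G" using dc lc by blast
    then obtain h where h: "h \<in> H" "d \<otimes> letter_value G l \<in> h <# D" using tiles_cover by blast
    have hc: "h \<in> carrier G" using h H_closed by blast
    have x_in: "x \<otimes> letter_value G l \<in> (word_value G w \<otimes> h) <# D"
    proof -
      have "x \<otimes> letter_value G l = word_value G w \<otimes> (d \<otimes> letter_value G l)"
        using w(3) dc wc lc by (simp add: m_assoc)
      then have "x \<otimes> letter_value G l \<in> word_value G w <# (h <# D)"
        using h(2) by (auto simp: l_coset_def)
      then show ?thesis using tile_tile[OF wc hc] by simp
    qed
    have "\<exists>u\<in>reduced_words schreier_gens. word_value G u = word_value G w \<otimes> h"
    proof (cases "h = \<one>")
      case False
      then obtain m where m: "m \<in> schreier_gens \<times> UNIV" "letter_value G m = h"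
        using exists_letter[OF h(1) _ w(2) l h(2)] by blast
      show ?thesis
      proof (cases rule: T.reduced_word_mult_letter[OF w(1) m(1)])
        case 1
        then show ?thesis
          using T.word_value_snoc[OF reduced_words_in_lists[OF w(1)] m(1)] m(2) by metis
      next
        case (2 u)
        then show ?thesis using m(2) by metis
      qed
    qed (use w(1) wc in auto)
    then obtain u where "u \<in> reduced_words schreier_gens" "word_value G u = word_value G w \<otimes> h"
      by blast
    then show "x \<otimes> letter_value G l \<in> ?U" using x_in by (intro CollectI bexI[of _ u]) simp_all
  qed
  show "H \<subseteq> word_value G ` reduced_words schreier_gens"
  proof
    fix h assume h: "h \<in> H"
    have hD: "h \<in> h <# D" using one_in_D h H_closed by (force simp: l_coset_def)
    obtain w where w: "w \<in> reduced_words schreier_gens" "h \<in> word_value G w <# D"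
      using \<open>carrier G \<subseteq> ?U\<close> h H_closed by blast
    have "word_value G w \<in> H" using word_value_in_H[OF reduced_words_in_lists[OF w(1)]] .
    then show "h \<in> word_value G ` reduced_words schreier_gens"
      using tiles_disjoint[OF h _ hD w(2)] w(1) by blast
  qed
qed

section \<open>The subgroup as a group of its own, and its right pasts\<close>

lemma letter_value_restrict:
  "l \<in> schreier_gens \<times> UNIV \<Longrightarrow> letter_value (G\<lparr>carrier := H\<rparr>) l = letter_value G l"
  using m_inv_consistent[OF subgroup_H] schreier_gens_subset by (cases l) auto

lemma free_generating_set_schreier_gens:
  "free_generating_set (G\<lparr>carrier := H\<rparr>) schreier_gens"
proof -
  have "word_value (G\<lparr>carrier := H\<rparr>) w = word_value G w" if "w \<in> lists (schreier_gens \<times> UNIV)" for w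
    using that by (induction w) (simp_all add: word_value_def letter_value_restrict del: mem_Times_iff)
  then have "bij_betw (word_value (G\<lparr>carrier := H\<rparr>)) (reduced_words schreier_gens) H"
    using bij_betw_cong[of "reduced_words schreier_gens" "word_value (G\<lparr>carrier := H\<rparr>)" "word_value G" H]
      schreier_word_value_inj schreier_word_value_surj reduced_words_in_lists
    unfolding bij_betw_def by blast
  then show ?thesis using schreier_gens_subset by (simp add: free_generating_set_def)
qed

lemma sym_gens_restrict:
  "sym_gens (G\<lparr>carrier := H\<rparr>) schreier_gens = letter_value G ` (schreier_gens \<times> UNIV)"
proof -
  have "m_inv (G\<lparr>carrier := H\<rparr>) ` schreier_gens = m_inv G ` schreier_gens"
    using m_inv_consistent[OF subgroup_H] schreier_gens_subset by (intro image_cong) auto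
  then show ?thesis using T.sym_gens_eq by (simp add: sym_gens_def)
qed

text \<open>Consecutive vertices of the path have tiles joined by an edge. The only edge into
  \<open>far l\<close> lands in the tile of \<open>letter_value G l\<close>, and on a simple path
  through \<open>\<one>\<close> that vertex comes after \<open>\<one>\<close>, so the tiles before
  \<open>\<one>\<close> never enter.\<close>

lemma RPast_tile_disjnt_far:
  assumes l: "l \<in> schreier_gens \<times> UNIV"
    and g: "g \<in> RPast (G\<lparr>carrier := H\<rparr>) schreier_gens \<one> (letter_value G l)"
  shows "(g <# D) \<inter> far l = {}"
proof -
  let ?edge = "cayley_edge (G\<lparr>carrier := H\<rparr>) schreier_gens"
  let ?v = "letter_value G l"
  obtain p where "simple_path (G\<lparr>carrier := H\<rparr>) schreier_gens g ?v p" "\<one> \<in> set p"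
    using g by (auto simp: RPast_def)
  then have p: "p \<noteq> []" "hd p = g" "last p = ?v" "distinct p" "successively ?edge p" "\<one> \<in> set p"
    unfolding simple_path_def by simp_all
  obtain q r where q: "p = q @ \<one> # r" using split_list[OF p(6)] by blast
  have "r \<noteq> []" using p(3) q letter_value_schreier_neq_one[OF l] by auto
  then have "?v \<in> set r" using p(3) q last_in_set[of r] by simp
  then have v: "?v \<notin> set q" using p(4) q by auto
  have "successively ?edge (q @ [\<one>])"
    using p(5) unfolding q successively_append_iff by (auto simp: successively_Cons)
  \<comment> \<open>The induction prepends one vertex at a time, so it walks from
    \<open>\<one>\<close> back to \<open>g\<close>.\<close>
  then have "(hd (q @ [\<one>]) <# D) \<inter> far l = {}"
    using v
  proof (induction q)
    case Nil
    then show ?case using D_disjnt_far[OF l] one_l_coset_D by simp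
  next
    case (Cons x q)
    let ?y = "hd (q @ [\<one>])"
    have suc: "successively ?edge (q @ [\<one>])" and edge: "?edge x ?y"
      using Cons.prems(1) by (auto simp: successively_Cons)
    then have IH: "(?y <# D) \<inter> far l = {}" using Cons by simp
    obtain m where m: "m \<in> schreier_gens \<times> UNIV" "?y = x \<otimes> letter_value G m" and x: "x \<in> H"
      using edge unfolding cayley_edge_def sym_gens_restrict by auto
    let ?d = "fst (exit m)" and ?k = "snd (exit m)"
    have xc: "x \<in> carrier G" using x H_closed by blast
    have xd: "x \<otimes> ?d \<in> x <# D" using exit(1)[OF m(1)] by (auto simp: l_coset_def)
    have xdc: "x \<otimes> ?d \<in> carrier G" using xc exit(2)[OF m(1)] by blast
    have "x \<otimes> (?d \<otimes> letter_value G ?k) \<in> x <# (letter_value G m <# D)"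
      using exit(5)[OF m(1)] unfolding l_coset_def[of G x] by blast
    then have xdk: "x \<otimes> ?d \<otimes> letter_value G ?k \<in> ?y <# D"
      using tile_tile[OF xc T.letter_value_closed[OF m(1)]] m(2) xc exit(2,3)[OF m(1)]
      by (simp add: m_assoc del: mem_Times_iff)
    have ne: "x \<noteq> ?v" using Cons.prems(2) by auto
    \<comment> \<open>Otherwise the edge between the two tiles, read from the tile of
      \<open>?y\<close> to that of \<open>x\<close>, enters \<open>far l\<close>. It is then the
      exit edge of \<open>l\<close>, which forces \<open>x\<close> to be \<open>?v\<close>.\<close>
    have "x \<otimes> ?d \<notin> far l"
    proof
      assume "x \<otimes> ?d \<in> far l"
      moreover have "x \<otimes> ?d \<otimes> letter_value G ?k \<notin> far l" using xdk IH by blast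
      moreover have k': "letter_inv ?k \<in> S \<times> UNIV" using exit(3)[OF m(1)] by (simp only: letter_inv_in_letters)
      moreover have return: "x \<otimes> ?d \<otimes> letter_value G ?k \<otimes> letter_value G (letter_inv ?k) = x \<otimes> ?d"
        using xdc exit(3)[OF m(1)] by (simp del: mem_Times_iff)
      ultimately have "x \<otimes> ?d \<otimes> letter_value G ?k = fst (exit l) \<and> letter_inv ?k = snd (exit l)"
        using crossing_edge[OF exit(2)[OF l] _ k', of "x \<otimes> ?d \<otimes> letter_value G ?k" "snd (exit l)"] xdc
          letter_value_closed[OF exit(3)[OF m(1)]]
        unfolding far_def by simp
      then have "x \<otimes> ?d = fst (exit l) \<otimes> letter_value G (snd (exit l))" using return by simp
      then have "x \<otimes> ?d \<in> ?v <# D" using exit(5)[OF l] by simp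
      then show False using tiles_disjoint[OF x letter_value_in_H[OF l] xd] ne by blast
    qed
    then show ?case using tile_disjnt_far[OF l x ne xd] by simp
  qed
  moreover have "hd (q @ [\<one>]) = g" using p(2) q by (cases q) auto
  ultimately show ?thesis by simp
qed

end

section \<open>Conditional probabilities given a countable partition\<close>

text \<open>As \<open>A\<close> belongs to \<open>F\<close>, its indicator can be pulled out of the
  conditional expectation, so it suffices to identify that of \<open>A \<inter> C\<close>. The
  product form of \<open>factor\<close> covers null \<open>A\<close> as well: the quotient is then
  \<open>0\<close> by convention and both sides vanish.\<close>

lemma real_cond_exp_indicator_on_atom:
  assumes "finite_measure M" "Conditional_Expectation.subalgebra M F" and A: "A \<in> sets F" and C: "C \<in> sets M"
    and factor: "\<And>Q. Q \<in> sets F \<Longrightarrow>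
      measure M (C \<inter> A \<inter> Q) * measure M A = measure M (C \<inter> A) * measure M (A \<inter> Q)"
  shows "AE x in M. x \<in> A \<longrightarrow> real_cond_exp M F (indicator C) x = measure M (C \<inter> A) / measure M A"
proof -
  interpret finite_measure_subalgebra M F
    using assms(1,2) by (simp add: finite_measure_subalgebra_def finite_measure_subalgebra_axioms_def)
  let ?c = "measure M (C \<inter> A) / measure M A"
  have sets: "Q \<in> sets M" if "Q \<in> sets F" for Q
    using that subalg by (auto simp: Conditional_Expectation.subalgebra_def)
  have [measurable]: "A \<in> sets M" "C \<in> sets M" using sets A C by auto
  have "AE x in M. real_cond_exp M F (\<lambda>x. indicator A x * indicator C x) x = indicator A x * ?c"
  proof (rule real_cond_exp_charact)
    fix Q assume Q: "Q \<in> sets F"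
    have [measurable]: "Q \<in> sets M" using Q by (rule sets)
    have "(\<integral>x\<in>Q. indicator A x * indicator C x \<partial>M) = (\<integral>x. indicator (C \<inter> A \<inter> Q) x \<partial>M :: real)"
      unfolding set_lebesgue_integral_def
      by (intro Bochner_Integration.integral_cong) (auto simp: indicator_def)
    also have "\<dots> = measure M (C \<inter> A \<inter> Q)" by simp
    also have "\<dots> = ?c * measure M (A \<inter> Q)"
    proof (cases "measure M A = 0")
      case True
      have "measure M (C \<inter> A \<inter> Q) \<le> measure M A" by (rule finite_measure_mono) auto
      then show ?thesis using True by (simp add: measure_le_0_iff)
    next
      case False
      then show ?thesis using factor[OF Q] by (simp add: field_simps)
    qed
    also have "\<dots> = (\<integral>x. indicator (A \<inter> Q) x * ?c \<partial>M)" by simp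
    also have "\<dots> = (\<integral>x\<in>Q. indicator A x * ?c \<partial>M)"
      unfolding set_lebesgue_integral_def
      by (intro Bochner_Integration.integral_cong) (auto simp: indicator_def)
    finally show "(\<integral>x\<in>Q. indicator A x * indicator C x \<partial>M) = (\<integral>x\<in>Q. indicator A x * ?c \<partial>M)" .
  next
    have "integrable M (indicator (A \<inter> C) :: _ \<Rightarrow> real)"
      by (rule integrable_real_indicator) (auto simp: emeasure_eq_measure)
    then show "integrable M (\<lambda>x. indicator A x * indicator C x :: real)"
      by (subst (asm) indicator_inter_arith[abs_def])
    show "integrable M (\<lambda>x. indicator A x * ?c)"
      by (intro integrable_mult_left integrable_real_indicator) (auto simp: emeasure_eq_measure)
    show "(\<lambda>x. indicator A x * ?c) \<in> borel_measurable F" using A by measurable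
  qed
  moreover have "AE x in M. real_cond_exp M F (\<lambda>x. indicator A x * indicator C x) x =
      indicator A x * real_cond_exp M F (indicator C) x"
  proof (rule real_cond_exp_mult)
    show "indicator A \<in> borel_measurable F" using A by measurable
    have "integrable M (indicator (A \<inter> C) :: _ \<Rightarrow> real)"
      by (rule integrable_real_indicator) (auto simp: emeasure_eq_measure)
    then show "integrable M (\<lambda>x. indicator A x * indicator C x :: real)"
      by (subst (asm) indicator_inter_arith[abs_def])
  qed measurable
  ultimately show ?thesis by eventually_elim auto
qed

lemma subalgebra_sigma: "\<A> \<subseteq> sets M \<Longrightarrow> Conditional_Expectation.subalgebra M (sigma (space M) \<A>)"
proof -
  assume \<A>: "\<A> \<subseteq> sets M"
  then have "\<A> \<subseteq> Pow (space M)" using sets.space_closed by blast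
  then show ?thesis
    using sets.sigma_sets_subset[OF \<A>]
    by (simp add: Conditional_Expectation.subalgebra_def)
qed

lemma partition_atom_Int_sigma:
  assumes part: "countable_partition M \<alpha>" and A: "A \<in> \<alpha>"
    and Q: "Q \<in> sets (sigma (space M) \<alpha>)"
  shows "A \<inter> Q = {} \<or> A \<subseteq> Q"
proof -
  have "\<alpha> \<subseteq> Pow (space M)" "A \<subseteq> space M"
    using part A sets.sets_into_space by (auto simp: countable_partition_def)
  then have "Q \<in> sigma_sets (space M) \<alpha>" using Q by simp
  then show ?thesis
  proof induction
    case (Basic B)
    then have "A = B \<or> A \<inter> B = {}"
      using part A unfolding countable_partition_def partition_on_def disjoint_def by blast
    then show ?case by blast
  next
    case (Union B)
    then show ?case by blast
  qed (use \<open>A \<subseteq> space M\<close> in auto)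
qed

text \<open>The Markov condition becomes conditional independence of \<open>C\<close> and
  \<open>F\<close> given each atom, because conditioning on the partition gives a constant ratio
  there. One direction unpacks the hypothesis on \<open>G\<close>, the other assembles the
  conclusion for \<open>H\<close>.\<close>

lemma real_cond_exp_partition_iff:
  assumes fin: "finite_measure M" and part: "countable_partition M \<alpha>"
    and sub: "Conditional_Expectation.subalgebra M F" and \<alpha>F: "\<alpha> \<subseteq> sets F" and C: "C \<in> sets M"
  shows "(AE x in M. real_cond_exp M F (indicator C) x =
            real_cond_exp M (sigma (space M) \<alpha>) (indicator C) x) \<longleftrightarrow>
    (\<forall>A\<in>\<alpha>. \<forall>Q\<in>sets F.
       measure M (C \<inter> A \<inter> Q) * measure M A = measure M (C \<inter> A) * measure M (A \<inter> Q))"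
proof -
  interpret finite_measure_subalgebra M F
    using fin sub by (simp add: finite_measure_subalgebra_def finite_measure_subalgebra_axioms_def)
  let ?c = "\<lambda>A. measure M (C \<inter> A) / measure M A"
  have \<alpha>: "\<alpha> \<subseteq> sets M" "countable \<alpha>" "\<Union>\<alpha> = space M"
    using part by (auto simp: countable_partition_def partition_on_def)
  have sets_F: "Q \<in> sets M" if "Q \<in> sets F" for Q
    using that subalg by (auto simp: Conditional_Expectation.subalgebra_def)
  have on_sigma: "AE x in M. x \<in> A \<longrightarrow> real_cond_exp M (sigma (space M) \<alpha>) (indicator C) x = ?c A"
    if A: "A \<in> \<alpha>" for A
  proof (rule real_cond_exp_indicator_on_atom[OF fin subalgebra_sigma[OF \<alpha>(1)] _ C])
    have "\<alpha> \<subseteq> Pow (space M)" using \<alpha>(1) sets.space_closed by blast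
    then show "A \<in> sets (sigma (space M) \<alpha>)" using A by simp
    fix Q assume "Q \<in> sets (sigma (space M) \<alpha>)"
    then consider "A \<inter> Q = {}" | "A \<subseteq> Q" using partition_atom_Int_sigma[OF part A] by blast
    then show "measure M (C \<inter> A \<inter> Q) * measure M A = measure M (C \<inter> A) * measure M (A \<inter> Q)"
    proof cases
      case 1
      then show ?thesis by (simp add: Int_assoc)
    next
      case 2
      then show ?thesis by (simp add: Int_assoc Int_absorb2)
    qed
  qed
  show ?thesis
  proof (intro iffI ballI)
    assume eq: "AE x in M. real_cond_exp M F (indicator C) x =
      real_cond_exp M (sigma (space M) \<alpha>) (indicator C) x"
    fix A Q assume A: "A \<in> \<alpha>" and Q: "Q \<in> sets F"
    have [measurable]: "A \<in> sets M" "Q \<in> sets M" "C \<in> sets M" using A \<alpha> Q sets_F C by auto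
    have AQ: "A \<inter> Q \<in> sets F" using A \<alpha>F Q by blast
    have int: "integrable M (indicator C :: _ \<Rightarrow> real)"
      by (rule integrable_real_indicator) (auto simp: emeasure_eq_measure)
    have "measure M (C \<inter> A \<inter> Q) = (\<integral>x. indicator (C \<inter> A \<inter> Q) x \<partial>M)" by simp
    also have "\<dots> = (\<integral>x\<in>A \<inter> Q. indicator C x \<partial>M)"
      unfolding set_lebesgue_integral_def
      by (intro Bochner_Integration.integral_cong) (auto simp: indicator_def)
    also have "\<dots> = (\<integral>x\<in>A \<inter> Q. real_cond_exp M F (indicator C) x \<partial>M)"
      by (rule real_cond_exp_intA[OF int AQ])
    also have "\<dots> = (\<integral>x\<in>A \<inter> Q. ?c A \<partial>M)"
    proof (rule set_lebesgue_integral_cong_AE)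
      show "AE x\<in>A \<inter> Q in M. real_cond_exp M F (indicator C) x = ?c A"
        using eq on_sigma[OF A] by eventually_elim auto
    qed (auto simp: borel_measurable_cond_exp2)
    also have "\<dots> = ?c A * measure M (A \<inter> Q)"
      by (simp add: set_lebesgue_integral_def)
    finally have *: "measure M (C \<inter> A \<inter> Q) = ?c A * measure M (A \<inter> Q)" .
    show "measure M (C \<inter> A \<inter> Q) * measure M A = measure M (C \<inter> A) * measure M (A \<inter> Q)"
    proof (cases "measure M A = 0")
      case True
      have "measure M (C \<inter> A) \<le> measure M A" by (rule finite_measure_mono) auto
      then show ?thesis using True by (simp add: measure_le_0_iff)
    qed (simp add: *)
  next
    assume factor: "\<forall>A\<in>\<alpha>. \<forall>Q\<in>sets F.
       measure M (C \<inter> A \<inter> Q) * measure M A = measure M (C \<inter> A) * measure M (A \<inter> Q)"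
    \<comment> \<open>Countability of \<open>\<alpha>\<close> merges the exceptional null sets of
      the single atoms.\<close>
    have "AE x in M. \<forall>A\<in>\<alpha>. x \<in> A \<longrightarrow> real_cond_exp M F (indicator C) x = ?c A"
      using real_cond_exp_indicator_on_atom[OF fin sub _ C] factor \<alpha>F \<alpha>(2)
      by (intro AE_ball_countable') auto
    moreover have "AE x in M. \<forall>A\<in>\<alpha>. x \<in> A \<longrightarrow>
        real_cond_exp M (sigma (space M) \<alpha>) (indicator C) x = ?c A"
      using on_sigma \<alpha>(2) by (intro AE_ball_countable') auto
    ultimately show "AE x in M. real_cond_exp M F (indicator C) x =
        real_cond_exp M (sigma (space M) \<alpha>) (indicator C) x"
      using AE_space
    proof eventually_elim
      case (elim x)
      then obtain A where "A \<in> \<alpha>" "x \<in> A" using \<alpha>(3) by blast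
      then show ?case using elim by simp
    qed
  qed
qed

section \<open>Measure preserving actions\<close>

locale measure_preserving_action = group G for G (structure) +
  fixes M :: "'x measure" and a :: "'a \<Rightarrow> 'x \<Rightarrow> 'x"
  assumes pmp: "pmp_action G M a"
begin

sublocale group_action G "space M" a
  using pmp by (simp add: pmp_action_def)

sublocale prob_space M
  using pmp by (simp add: pmp_action_def standard_prob_space_def)

lemma act_measurable: "g \<in> carrier G \<Longrightarrow> a g \<in> measurable M M"
  using pmp by (simp add: pmp_action_def)

lemma distr_act: "g \<in> carrier G \<Longrightarrow> distr M M (a g) = M"
  using pmp by (simp add: pmp_action_def)

lemma act_inv_act: "g \<in> carrier G \<Longrightarrow> x \<in> space M \<Longrightarrow> a (inv g) (a g x) = x"
  using orbit_sym_aux by blast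

lemma act_one: "x \<in> space M \<Longrightarrow> a \<one> x = x"
  using id_eq_one by (metis restrict_apply')

lemma act_in_space: "g \<in> carrier G \<Longrightarrow> x \<in> space M \<Longrightarrow> a g x \<in> space M"
  using element_image by blast

lemma image_subset_space: "g \<in> carrier G \<Longrightarrow> B \<subseteq> space M \<Longrightarrow> a g ` B \<subseteq> space M"
  using act_in_space by blast

lemma image_one: "B \<subseteq> space M \<Longrightarrow> a \<one> ` B = B"
  using act_one by (force simp: image_iff)

lemma image_mult:
  assumes "g \<in> carrier G" "h \<in> carrier G" "B \<subseteq> space M"
  shows "a g ` a h ` B = a (g \<otimes> h) ` B"
proof -
  have "a (g \<otimes> h) x = a g (a h x)" if "x \<in> B" for x
    using composition_rule[of x g h] assms that by blast
  then show ?thesis by (simp add: image_image)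
qed

text \<open>Translates are images, whereas measurability and \<open>distr\<close> speak of
  preimages; this is the bridge.\<close>

lemma image_eq_vimage:
  assumes g: "g \<in> carrier G" and B: "B \<subseteq> space M"
  shows "a g ` B = a (inv g) -` B \<inter> space M"
proof (intro equalityI subsetI)
  fix x assume "x \<in> a (inv g) -` B \<inter> space M"
  moreover then have "a g (a (inv g) x) = x" using act_inv_act[of "inv g" x] g by simp
  ultimately show "x \<in> a g ` B" by (metis IntD1 image_eqI vimageE)
qed (use g B act_inv_act act_in_space in \<open>auto simp: subset_iff\<close>)

lemma image_sets: "g \<in> carrier G \<Longrightarrow> B \<in> sets M \<Longrightarrow> a g ` B \<in> sets M"
  using image_eq_vimage[of g B] measurable_sets[OF act_measurable[of "inv g"]]
    sets.sets_into_space[of B M]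
  by simp

lemma measure_image:
  assumes g: "g \<in> carrier G" and B: "B \<in> sets M"
  shows "measure M (a g ` B) = measure M B"
proof -
  have "measure M B = measure (distr M M (a (inv g))) B" using distr_act[of "inv g"] g by simp
  also have "\<dots> = measure M (a (inv g) -` B \<inter> space M)"
    using measure_distr[OF act_measurable[of "inv g"] B] g by simp
  finally show ?thesis using image_eq_vimage[OF g sets.sets_into_space[OF B]] by simp
qed

lemma image_Int:
  "g \<in> carrier G \<Longrightarrow> A \<subseteq> space M \<Longrightarrow> B \<subseteq> space M \<Longrightarrow> a g ` (A \<inter> B) = a g ` A \<inter> a g ` B"
  using inj_on_image_Int[OF inj_prop] by blast

context
  fixes \<alpha> assumes \<alpha>: "\<alpha> \<subseteq> sets M"
begin

lemma translates_generators: "F \<subseteq> carrier G \<Longrightarrow> (\<Union>f\<in>F. (\<lambda>A. a f ` A) ` \<alpha>) \<subseteq> sets M"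
  using \<alpha> image_sets by blast

lemma space_translates [simp]: "space (translates M a F \<alpha>) = space M"
  by (simp add: translates_def space_measure_of_conv)

lemma sets_translates:
  assumes "F \<subseteq> carrier G"
  shows "sets (translates M a F \<alpha>) = sigma_sets (space M) (\<Union>f\<in>F. (\<lambda>A. a f ` A) ` \<alpha>)"
  unfolding translates_def
  using translates_generators[OF assms] sets.space_closed by (intro sets_measure_of) blast

lemma subalgebra_translates: "F \<subseteq> carrier G \<Longrightarrow> Conditional_Expectation.subalgebra M (translates M a F \<alpha>)"
  unfolding translates_def by (rule subalgebra_sigma[OF translates_generators])

lemma in_translates:
  "F \<subseteq> carrier G \<Longrightarrow> f \<in> F \<Longrightarrow> A \<in> \<alpha> \<Longrightarrow> a f ` A \<in> sets (translates M a F \<alpha>)"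
  by (subst sets_translates) (auto intro: sigma_sets.Basic)

lemma translates_mono:
  assumes "F \<subseteq> F'" "F' \<subseteq> carrier G"
  shows "sets (translates M a F \<alpha>) \<subseteq> sets (translates M a F' \<alpha>)"
proof -
  have "F \<subseteq> carrier G" using assms by blast
  then show ?thesis using assms(2) sigma_sets_mono'[of "\<Union>f\<in>F. (\<lambda>A. a f ` A) ` \<alpha>"] assms(1)
    by (simp add: sets_translates UN_mono)
qed

text \<open>Needed to move the Markov property from \<open>\<one>\<close> to other vertices.
  Bijectivity of \<open>a g\<close> makes images commute with complements.\<close>

lemma image_translates:
  assumes g: "g \<in> carrier G" and F: "F \<subseteq> carrier G" and Q: "Q \<in> sets (translates M a F \<alpha>)"
  shows "a g ` Q \<in> sets (translates M a (g <# F) \<alpha>)"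
proof -
  let ?N = "translates M a (g <# F) \<alpha>"
  have gF: "g <# F \<subseteq> carrier G" using g F by (rule l_coset_subset_G[rotated])
  have "Q \<in> sigma_sets (space M) (\<Union>f\<in>F. (\<lambda>A. a f ` A) ` \<alpha>)"
    using Q sets_translates[OF F] by simp
  then show ?thesis
  proof induction
    case (Basic B)
    then obtain f A where fA: "f \<in> F" "A \<in> \<alpha>" "B = a f ` A" by auto
    have "A \<subseteq> space M" "f \<in> carrier G" using fA \<alpha> F sets.sets_into_space[of A M] by auto
    then have "a g ` B = a (g \<otimes> f) ` A" using image_mult[OF g] fA(3) by simp
    moreover have "g \<otimes> f \<in> g <# F" using fA(1) by (auto simp: l_coset_def)
    ultimately show ?case using in_translates[OF gF] fA(2) by simp
  next
    case (Compl B)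
    have "B \<in> sets M"
      using Compl.hyps sets.sigma_sets_subset[OF translates_generators[OF F]] by blast
    then have "a g ` (space M - B) = space M - a g ` B"
      using inj_on_image_set_diff[OF inj_prop[OF g], of "space M" B] surj_prop[OF g]
        sets.sets_into_space by auto
    then show ?case using sets.compl_sets[OF Compl.IH] by simp
  next
    case (Union B)
    then show ?case unfolding image_UN by blast
  qed simp
qed

end

lemma restrict_subgroup:
  assumes H: "subgroup H G"
  shows "pmp_action (G\<lparr>carrier := H\<rparr>) M a"
proof -
  have Hc: "H \<subseteq> carrier G" using H by (rule subgroup.subset)
  have "group_hom (G\<lparr>carrier := H\<rparr>) (BijGroup (space M)) a"
  proof -
    have "group (G\<lparr>carrier := H\<rparr>)" using subgroup.subgroup_is_group[OF H is_group] .
    moreover have "a \<in> hom (G\<lparr>carrier := H\<rparr>) (BijGroup (space M))"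
      using group_hom Hc unfolding group_hom_def group_hom_axioms_def hom_def by auto
    ultimately show ?thesis
      using group_hom unfolding group_hom_def group_hom_axioms_def by blast
  qed
  then show ?thesis using pmp Hc unfolding pmp_action_def group_action_def by auto
qed

end

lemma countable_partitionD:
  assumes "countable_partition M \<alpha>"
  shows "\<alpha> \<subseteq> sets M" "countable \<alpha>" "\<Union>\<alpha> = space M" "{} \<notin> \<alpha>"
    "A \<in> \<alpha> \<Longrightarrow> B \<in> \<alpha> \<Longrightarrow> x \<in> A \<Longrightarrow> x \<in> B \<Longrightarrow> A = B" "A \<in> \<alpha> \<Longrightarrow> A \<subseteq> space M"
  using assms unfolding countable_partition_def partition_on_def disjoint_def by blast+

section \<open>Joins of finitely many translates of a partition\<close>

context measure_preserving_action
begin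

text \<open>The points whose \<alpha>-name on \<open>E\<close> is \<open>f\<close>. For empty
  \<open>E\<close> the intersection is \<open>UNIV\<close>, whence the assumptions that
  \<open>E\<close> is nonempty.\<close>

definition cylinder :: "('a \<Rightarrow> 'x set) \<Rightarrow> 'a set \<Rightarrow> 'x set" where
  "cylinder f E = (\<Inter>e\<in>E. a e ` f e)"

text \<open>Extensional functions keep the family countable for finite \<open>E\<close> and give
  each atom a single name. The empty set is removed because a partition has no empty member.\<close>

definition join_translates :: "'a set \<Rightarrow> 'x set set \<Rightarrow> 'x set set" where
  "join_translates E \<alpha> = (\<lambda>f. cylinder f E) ` (E \<rightarrow>\<^sub>E \<alpha>) - {{}}"

lemma cylinder_in_translates:
  assumes "\<alpha> \<subseteq> sets M" "F \<subseteq> carrier G" "E \<subseteq> F" "finite E" "E \<noteq> {}" "f \<in> E \<rightarrow> \<alpha>"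
  shows "cylinder f E \<in> sets (translates M a F \<alpha>)"
  unfolding cylinder_def
proof (rule sets.finite_INT)
  fix e assume "e \<in> E"
  then show "a e ` f e \<in> sets (translates M a F \<alpha>)"
    using assms by (intro in_translates) auto
qed (use assms in auto)

lemma image_cylinder:
  assumes h: "h \<in> carrier G" and E: "E \<subseteq> carrier G" "E \<noteq> {}" and f: "f \<in> E \<rightarrow> Pow (space M)"
  shows "a h ` cylinder f E = cylinder (\<lambda>x. f (inv h \<otimes> x)) (h <# E)"
proof -
  obtain e0 where e0: "e0 \<in> E" using E by blast
  have "a h ` cylinder f E = (\<Inter>e\<in>E. a h ` a e ` f e)"
    unfolding cylinder_def
  proof (rule image_INT[OF inj_prop[OF h] _ e0], rule ballI)
    fix e assume e: "e \<in> E"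
    show "a e ` f e \<subseteq> space M" by (rule image_subset_space) (use e E f in auto)
  qed
  also have "\<dots> = (\<Inter>e\<in>E. a (h \<otimes> e) ` f (inv h \<otimes> (h \<otimes> e)))"
  proof (rule INF_cong)
    fix e assume e: "e \<in> E"
    have "e \<in> carrier G" "f e \<subseteq> space M" using e E f by auto
    then show "a h ` a e ` f e = a (h \<otimes> e) ` f (inv h \<otimes> (h \<otimes> e))"
      using image_mult[OF h] h by (simp add: m_assoc[symmetric])
  qed simp
  also have "\<dots> = cylinder (\<lambda>x. f (inv h \<otimes> x)) (h <# E)"
    unfolding cylinder_def l_coset_def by auto
  finally show ?thesis .
qed

context
  fixes \<alpha> E
  assumes part: "countable_partition M \<alpha>" and E: "E \<subseteq> carrier G" "finite E" "E \<noteq> {}"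
begin

lemmas partition_facts = countable_partitionD[OF part]

lemma mem_cylinder_iff:
  assumes f: "f \<in> E \<rightarrow> \<alpha>" and x: "x \<in> space M"
  shows "x \<in> cylinder f E \<longleftrightarrow> (\<forall>e\<in>E. a (inv e) x \<in> f e)"
proof -
  have "a e ` f e = a (inv e) -` f e \<inter> space M" if e: "e \<in> E" for e
    by (rule image_eq_vimage) (use e E f partition_facts(6) in blast)+
  then show ?thesis using x unfolding cylinder_def by simp
qed

lemma cylinder_sets_join:
  assumes f: "f \<in> E \<rightarrow> \<alpha>"
  shows "cylinder f E \<in> sets M" "cylinder f E \<subseteq> space M"
proof -
  show "cylinder f E \<in> sets M"
    using cylinder_in_translates[OF partition_facts(1) E(1) order_refl E(2,3) f]
      subalgebra_translates[OF partition_facts(1) E(1)]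
    by (auto simp: Conditional_Expectation.subalgebra_def)
  then show "cylinder f E \<subseteq> space M" by (rule sets.sets_into_space)
qed

lemma point_in_join:
  assumes x: "x \<in> space M"
  shows "\<exists>f\<in>E \<rightarrow>\<^sub>E \<alpha>. x \<in> cylinder f E"
proof -
  have "\<exists>A. A \<in> \<alpha> \<and> a (inv e) x \<in> A" if e: "e \<in> E" for e
  proof -
    have "a (inv e) x \<in> space M" using e E x act_in_space by auto
    then show ?thesis using partition_facts(3) by blast
  qed
  then obtain g where g: "\<And>e. e \<in> E \<Longrightarrow> g e \<in> \<alpha> \<and> a (inv e) x \<in> g e" by metis
  have "restrict g E \<in> E \<rightarrow>\<^sub>E \<alpha>" using g by auto
  moreover have "x \<in> cylinder (restrict g E) E"
    using mem_cylinder_iff[of "restrict g E" x] x g by auto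
  ultimately show ?thesis by blast
qed

lemma countable_partition_join: "countable_partition M (join_translates E \<alpha>)"
  unfolding countable_partition_def
proof (intro conjI partition_onI)
  show "countable (join_translates E \<alpha>)"
    unfolding join_translates_def
    using countable_PiE[OF E(2), of "\<lambda>_. \<alpha>"] partition_facts(2) by auto
  show "join_translates E \<alpha> \<subseteq> sets M"
    unfolding join_translates_def using cylinder_sets_join(1) by (auto simp: PiE_def)
  show "\<Union> (join_translates E \<alpha>) = space M"
  proof
    show "\<Union> (join_translates E \<alpha>) \<subseteq> space M"
      unfolding join_translates_def using cylinder_sets_join(2) by (fastforce simp: PiE_def)
    show "space M \<subseteq> \<Union> (join_translates E \<alpha>)"
      unfolding join_translates_def using point_in_join by blast
  qed
  fix B B' assume B: "B \<in> join_translates E \<alpha>" "B' \<in> join_translates E \<alpha>" "B \<noteq> B'"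
  obtain f where f: "f \<in> E \<rightarrow>\<^sub>E \<alpha>" "B = cylinder f E" using B(1) unfolding join_translates_def by blast
  obtain g where g: "g \<in> E \<rightarrow>\<^sub>E \<alpha>" "B' = cylinder g E" using B(2) unfolding join_translates_def by blast
  have fg: "f \<in> E \<rightarrow> \<alpha>" "g \<in> E \<rightarrow> \<alpha>" using f(1) g(1) unfolding PiE_def by auto
  show "disjnt B B'"
  proof (rule ccontr)
    assume "\<not> disjnt B B'"
    then obtain x where x: "x \<in> cylinder f E" "x \<in> cylinder g E" unfolding disjnt_def f(2) g(2) by blast
    have xs: "x \<in> space M" using x cylinder_sets_join(2)[OF fg(1)] by blast
    have "f = g"
    proof (rule PiE_ext[OF f(1) g(1)])
      fix e assume e: "e \<in> E"
      have "a (inv e) x \<in> f e" "a (inv e) x \<in> g e"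
        using x xs mem_cylinder_iff[OF fg(1)] mem_cylinder_iff[OF fg(2)] e by auto
      then show "f e = g e" using partition_facts(5) fg e by blast
    qed
    then show False using f g B(3) by simp
  qed
qed (auto simp: join_translates_def)

lemma translate_eq_Union_join:
  assumes e: "e \<in> E" and A: "A \<in> \<alpha>"
  shows "a e ` A = \<Union> {B \<in> join_translates E \<alpha>. B \<subseteq> a e ` A}"
proof
  show "a e ` A \<subseteq> \<Union> {B \<in> join_translates E \<alpha>. B \<subseteq> a e ` A}"
  proof
    fix x assume x: "x \<in> a e ` A"
    have eA: "a e ` A = a (inv e) -` A \<inter> space M"
      by (rule image_eq_vimage) (use e E A partition_facts(6) in blast)+
    have xs: "x \<in> space M" using x eA by blast
    obtain f where f: "f \<in> E \<rightarrow>\<^sub>E \<alpha>" "x \<in> cylinder f E" using point_in_join[OF xs] by blast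
    have f': "f \<in> E \<rightarrow> \<alpha>" using f(1) unfolding PiE_def by blast
    have "a (inv e) x \<in> f e" using mem_cylinder_iff[OF f' xs] f(2) e by blast
    then have "f e = A" using partition_facts(5)[of "f e" A] f' e A x eA by blast
    then have "cylinder f E \<subseteq> a e ` A" using e unfolding cylinder_def by blast
    moreover have "cylinder f E \<in> join_translates E \<alpha>"
      using f unfolding join_translates_def by blast
    ultimately show "x \<in> \<Union> {B \<in> join_translates E \<alpha>. B \<subseteq> a e ` A}" using f(2) by blast
  qed
qed blast

text \<open>Used with \<open>F\<close> a right past in the subgroup and \<open>F'\<close> the
  complement of a set \<open>far l\<close>.\<close>

lemma translates_join_subset:
  assumes F: "F \<subseteq> carrier G" and F': "F' \<subseteq> carrier G" and sub: "\<And>h. h \<in> F \<Longrightarrow> h <# E \<subseteq> F'"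
  shows "sets (translates M a F (join_translates E \<alpha>)) \<subseteq> sets (translates M a F' \<alpha>)"
proof -
  let ?N = "translates M a F' \<alpha>"
  have "(\<Union>h\<in>F. (\<lambda>B. a h ` B) ` join_translates E \<alpha>) \<subseteq> sets ?N"
  proof
    fix Z assume "Z \<in> (\<Union>h\<in>F. (\<lambda>B. a h ` B) ` join_translates E \<alpha>)"
    then obtain h f where hf: "h \<in> F" "f \<in> E \<rightarrow>\<^sub>E \<alpha>" "Z = a h ` cylinder f E"
      unfolding join_translates_def by blast
    have hc: "h \<in> carrier G" using hf(1) F by blast
    have f: "f \<in> E \<rightarrow> \<alpha>" using hf(2) unfolding PiE_def by blast
    then have "f \<in> E \<rightarrow> Pow (space M)" using partition_facts(6) by blast
    then have "Z = cylinder (\<lambda>x. f (inv h \<otimes> x)) (h <# E)"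
      using image_cylinder[OF hc E(1,3)] hf(3) by simp
    moreover have "(\<lambda>x. f (inv h \<otimes> x)) \<in> (h <# E) \<rightarrow> \<alpha>"
    proof
      fix x assume "x \<in> h <# E"
      then obtain e where e: "e \<in> E" "x = h \<otimes> e" by (auto simp: l_coset_def)
      then have "inv h \<otimes> x = e" using hc E(1) by (auto simp: m_assoc[symmetric])
      then show "f (inv h \<otimes> x) \<in> \<alpha>" using f e(1) by auto
    qed
    moreover have "finite (h <# E)" "h <# E \<noteq> {}" using E by (auto simp: l_coset_def)
    ultimately show "Z \<in> sets ?N"
      using cylinder_in_translates[OF partition_facts(1) F' sub[OF hf(1)]] by simp
  qed
  then have "sigma_sets (space ?N) (\<Union>h\<in>F. (\<lambda>B. a h ` B) ` join_translates E \<alpha>) \<subseteq> sets ?N"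
    by (rule sets.sigma_sets_subset)
  moreover have "join_translates E \<alpha> \<subseteq> sets M"
    using countable_partition_join by (simp add: countable_partition_def)
  ultimately show ?thesis
    using sets_translates[OF _ F] space_translates[OF partition_facts(1)] by simp
qed

text \<open>Used for generation. Each translate of an atom of \<open>\<alpha>\<close> is a countable
  union of translated atoms of the join.\<close>

lemma translates_subset_translates_join:
  assumes F: "F \<subseteq> carrier G" and cover: "\<And>g. g \<in> F' \<Longrightarrow> \<exists>h\<in>F. g \<in> h <# E" and F': "F' \<subseteq> carrier G"
  shows "sets (translates M a F' \<alpha>) \<subseteq> sets (translates M a F (join_translates E \<alpha>))"
proof -
  let ?N = "translates M a F (join_translates E \<alpha>)"
  have join: "join_translates E \<alpha> \<subseteq> sets M" "countable (join_translates E \<alpha>)"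
    using countable_partition_join by (simp_all add: countable_partition_def)
  have "(\<Union>g\<in>F'. (\<lambda>A. a g ` A) ` \<alpha>) \<subseteq> sets ?N"
  proof
    fix Z assume "Z \<in> (\<Union>g\<in>F'. (\<lambda>A. a g ` A) ` \<alpha>)"
    then obtain g A where gA: "g \<in> F'" "A \<in> \<alpha>" "Z = a g ` A" by blast
    then obtain h where h: "h \<in> F" "g \<in> h <# E" using cover by blast
    then obtain e where e: "e \<in> E" "g = h \<otimes> e" by (auto simp: l_coset_def)
    let ?\<B> = "{B \<in> join_translates E \<alpha>. B \<subseteq> a e ` A}"
    have "Z = a h ` a e ` A"
      using image_mult[of h e A] h(1) F e E(1) gA partition_facts(6) by auto
    also have "\<dots> = a h ` \<Union>?\<B>" using translate_eq_Union_join[OF e(1) gA(2)] by simp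
    also have "\<dots> = (\<Union>B\<in>?\<B>. a h ` B)" by (simp add: image_Union)
    also have "\<dots> \<in> sets ?N"
    proof (rule sets.countable_UN'')
      show "countable ?\<B>" using join(2) by (rule countable_subset[rotated]) blast
      show "\<And>B. B \<in> ?\<B> \<Longrightarrow> a h ` B \<in> sets ?N" using in_translates[OF join(1) F h(1)] by blast
    qed
    finally show "Z \<in> sets ?N" .
  qed
  then have "sigma_sets (space ?N) (\<Union>g\<in>F'. (\<lambda>A. a g ` A) ` \<alpha>) \<subseteq> sets ?N"
    by (rule sets.sigma_sets_subset)
  then show ?thesis
    using sets_translates[OF partition_facts(1) F'] space_translates[OF join(1)] by simp
qed

end

end

section \<open>Markov processes over finite connected sets\<close>

locale tree_markov_process = free_generators G S for G (structure) and S +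
  fixes M :: "'x measure" and a :: "'a \<Rightarrow> 'x \<Rightarrow> 'x" and \<alpha> :: "'x set set"
  assumes markov: "markov_process_wrt G M a S \<alpha>"
begin

sublocale measure_preserving_action G M a
  using markov by unfold_locales (simp add: markov_process_wrt_def)

lemma partition: "countable_partition M \<alpha>"
  using markov by (simp add: markov_process_wrt_def)

lemmas atoms = countable_partitionD[OF partition]

lemma markov_at_one:
  assumes r: "r \<in> S \<times> UNIV" and A: "A \<in> \<alpha>" and B: "B \<in> \<alpha>"
    and R: "R \<in> sets (translates M a (carrier G - half_tree \<one> r) \<alpha>)"
  shows "measure M (a (letter_value G r) ` A \<inter> B \<inter> R) * measure M B =
    measure M (a (letter_value G r) ` A \<inter> B) * measure M (B \<inter> R)"
proof -
  let ?v = "letter_value G r"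
  let ?F = "translates M a (RPast G S \<one> ?v) \<alpha>"
  have RP: "RPast G S \<one> ?v \<subseteq> carrier G" by (auto simp: RPast_def)
  have sub: "carrier G - half_tree \<one> r \<subseteq> RPast G S \<one> ?v"
    by (rule complement_half_tree_subset_RPast[OF r])
  have R': "R \<in> sets ?F" using translates_mono[OF atoms(1) sub RP] R by blast
  have "\<one> \<in> RPast G S \<one> ?v" using sub source_notin_half_tree[of \<one> r] by blast
  then have \<alpha>F: "\<alpha> \<subseteq> sets ?F"
    using in_translates[OF atoms(1) RP] image_one[OF atoms(6)] by force
  have v: "?v \<in> sym_gens G S" using r by (simp only: sym_gens_eq imageI)
  have C: "a ?v ` A \<in> sets M" using image_sets letter_value_closed[OF r] A atoms(1) by blast
  have "\<forall>A\<in>\<alpha>. \<forall>s\<in>sym_gens G S. AE x in M.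
      real_cond_exp M (translates M a (RPast G S \<one> s) \<alpha>) (indicator (a s ` A)) x =
      real_cond_exp M (sigma (space M) \<alpha>) (indicator (a s ` A)) x"
    using markov unfolding markov_process_wrt_def by blast
  then have "AE x in M. real_cond_exp M ?F (indicator (a ?v ` A)) x =
      real_cond_exp M (sigma (space M) \<alpha>) (indicator (a ?v ` A)) x"
    using A v by blast
  then show ?thesis
    using real_cond_exp_partition_iff[OF finite_measure_axioms partition
        subalgebra_translates[OF atoms(1) RP] \<alpha>F C] B R' by blast
qed

text \<open>The case of the vertex \<open>\<one>\<close> carried along by \<open>y\<close>: the
  action preserves measure, and \<open>inv y\<close> sends the complement of the half tree at
  \<open>y\<close> into that of the half tree at \<open>\<one>\<close>.\<close>

lemma markov_at_edge:
  assumes y: "y \<in> carrier G" and r: "r \<in> S \<times> UNIV" and A: "A \<in> \<alpha>" and B: "B \<in> \<alpha>"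
    and R: "R \<in> sets (translates M a (carrier G - half_tree y r) \<alpha>)"
  shows "measure M (a (y \<otimes> letter_value G r) ` A \<inter> a y ` B \<inter> R) * measure M (a y ` B) =
    measure M (a (y \<otimes> letter_value G r) ` A \<inter> a y ` B) * measure M (a y ` B \<inter> R)"
proof -
  let ?v = "letter_value G r"
  let ?R = "a (inv y) ` R"
  have v: "?v \<in> carrier G" using r by (rule letter_value_closed)
  have P: "carrier G - half_tree y r \<subseteq> carrier G" by blast
  have "inv y <# (carrier G - half_tree y r) \<subseteq> carrier G - half_tree \<one> r"
  proof
    fix z assume "z \<in> inv y <# (carrier G - half_tree y r)"
    then obtain w where w: "w \<in> carrier G" "w \<notin> half_tree y r" "z = inv y \<otimes> w"
      by (auto simp: l_coset_def)
    have "w = y \<otimes> z" using w y by (simp add: m_assoc[symmetric])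
    then have "z \<notin> half_tree \<one> r"
      using w(2) l_coset_half_tree[OF y one_closed, of r] y unfolding l_coset_def by auto
    then show "z \<in> carrier G - half_tree \<one> r" using w y by blast
  qed
  then have R1: "?R \<in> sets (translates M a (carrier G - half_tree \<one> r) \<alpha>)"
    using image_translates[OF atoms(1) inv_closed[OF y] P R] translates_mono[OF atoms(1)] by blast
  have RM: "R \<in> sets M"
    using R subalgebra_translates[OF atoms(1) P] by (auto simp: Conditional_Expectation.subalgebra_def)
  have in_M: "a ?v ` A \<in> sets M" "B \<in> sets M" "?R \<in> sets M"
    using image_sets v y A B atoms(1) RM by auto
  note in_space = in_M[THEN sets.sets_into_space] RM[THEN sets.sets_into_space]
  have eqR: "a y ` ?R = R" using image_mult[OF y inv_closed[OF y] in_space(4)] image_one in_space(4) y by simp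
  have eqA: "a y ` a ?v ` A = a (y \<otimes> ?v) ` A" by (rule image_mult[OF y v atoms(6)[OF A]])
  have "measure M (a y ` (a ?v ` A \<inter> B \<inter> ?R)) * measure M (a y ` B) =
      measure M (a y ` (a ?v ` A \<inter> B)) * measure M (a y ` (B \<inter> ?R))"
    using markov_at_one[OF r A B R1] in_M by (simp add: measure_image[OF y])
  moreover have "a y ` (a ?v ` A \<inter> B) = a (y \<otimes> ?v) ` A \<inter> a y ` B"
    using image_Int[OF y in_space(1,2)] eqA by simp
  moreover have "a y ` (a ?v ` A \<inter> B \<inter> ?R) = a (y \<otimes> ?v) ` A \<inter> a y ` B \<inter> R"
    using image_Int[OF y _ in_space(3), of "a ?v ` A \<inter> B"] in_space image_Int[OF y in_space(1,2)] eqA eqR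
    by (simp add: le_infI1)
  moreover have "a y ` (B \<inter> ?R) = a y ` B \<inter> R"
    using image_Int[OF y in_space(2,3)] eqR by simp
  ultimately show ?thesis by simp
qed

text \<open>The set \<open>V\<close> is exhausted by adding one leaf at a time, starting from \<open>d\<close>; a leaf attached
  at \<open>y\<close> is independent of everything so far and of the past, given \<open>y \<cdot> \<alpha>\<close>.\<close>

lemma markov_connected:
  assumes d: "d \<in> carrier G" and l: "l \<in> S \<times> UNIV"
    and V: "finite V" "connected_set V" "V \<subseteq> half_tree d l" "d \<otimes> letter_value G l \<in> V"
    and f: "f \<in> insert d V \<rightarrow> \<alpha>"
    and Q: "Q \<in> sets (translates M a (carrier G - half_tree d l) \<alpha>)"
  shows "measure M (cylinder f (insert d V) \<inter> Q) * measure M (a d ` f d) =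
    measure M (cylinder f (insert d V)) * measure M (a d ` f d \<inter> Q)"
proof -
  let ?P = "carrier G - half_tree d l"
  have Vc: "V \<subseteq> carrier G" using V(3) half_tree_closed[OF d] by blast
  \<comment> \<open>A largest \<open>good\<close> set will be all of \<open>insert d V\<close>. The
    start \<open>{d}\<close> is trivial, since its cylinder is the conditioning set itself.\<close>
  define good where "good E \<longleftrightarrow> d \<in> E \<and> E \<subseteq> insert d V \<and> connected_set E \<and>
    measure M (cylinder f E \<inter> Q) * measure M (a d ` f d) =
    measure M (cylinder f E) * measure M (a d ` f d \<inter> Q)" for E
  have "good {d}" by (simp add: good_def connected_set_singleton cylinder_def mult.commute)
  moreover have "card E < Suc (card (insert d V))" if "good E" for E
  proof -
    have "card E \<le> card (insert d V)"
      using that V(1) unfolding good_def by (intro card_mono) auto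
    then show ?thesis by simp
  qed
  ultimately obtain E where good: "good E" and max: "\<And>E'. good E' \<Longrightarrow> card E' \<le> card E"
    using ex_has_greatest_nat[of good "{d}" card "Suc (card (insert d V))"] by blast
  have E: "d \<in> E" "E \<subseteq> insert d V" "connected_set E" "finite E" "E \<subseteq> carrier G"
    using good V(1) Vc d finite_subset[of E "insert d V"] unfolding good_def by auto
  have "connected_set (insert (d \<otimes> letter_value G l \<otimes> letter_value G (letter_inv l)) V)"
    using connected_set_insert[OF V(2,4) subsetD[OF Vc V(4)], of "letter_inv l"] l
    by (simp only: letter_inv_in_letters)
  then have conn: "connected_set (insert d V)" using d l by (simp del: mem_Times_iff)
  have "insert d V \<subseteq> E"
  proof (rule connected_setD[OF conn insertI1 E(1)])
    fix y r assume y: "y \<in> insert d V" "y \<in> E" and r: "r \<in> S \<times> UNIV"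
      and x: "y \<otimes> letter_value G r \<in> insert d V"
    let ?x = "y \<otimes> letter_value G r"
    show "?x \<in> E"
    proof (rule ccontr)
      assume new: "?x \<notin> E"
      have yc: "y \<in> carrier G" using y(2) E(5) by blast
      have xV: "?x \<in> V" using x new E(1) by auto
      \<comment> \<open>Both \<open>E\<close> and the past \<open>?P\<close> are connected and omit
        \<open>?x\<close>, the latter because \<open>?x\<close> lies in \<open>V\<close>. Hence
        neither meets the half tree beyond the new edge, and \<open>cylinder f E\<close> and
        \<open>Q\<close> both belong to the past of that edge.\<close>
      have "E \<inter> half_tree y r = {}"
        using connected_set_disjnt_half_tree[OF E(3,5) yc y(2) source_notin_half_tree[OF yc]] new by blast
      then have EP: "E \<subseteq> carrier G - half_tree y r" using E(5) by blast
      have "?P \<inter> half_tree y r = {}"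
      proof (rule connected_set_disjnt_half_tree[OF connected_complement_half_tree[OF d] _ yc])
        show "d \<in> ?P" using d source_notin_half_tree by blast
        show "d \<notin> half_tree y r" using EP E(1) by blast
        show "\<not> (y \<in> ?P \<and> ?x \<in> ?P)" using xV V(3) by blast
      qed blast
      then have PP: "?P \<subseteq> carrier G - half_tree y r" by blast
      let ?N = "translates M a (carrier G - half_tree y r) \<alpha>"
      have fx: "f ?x \<in> \<alpha>" "f y \<in> \<alpha>" using f x y(1) by auto
      have cyl: "cylinder f E \<in> sets ?N"
        using E f by (intro cylinder_in_translates[OF atoms(1) _ EP]) auto
      have cylQ: "cylinder f E \<inter> Q \<in> sets ?N"
        using cyl Q translates_mono[OF atoms(1) PP] by blast
      have absorb: "a y ` f y \<inter> cylinder f E = cylinder f E"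
        using y(2) unfolding cylinder_def by blast
      let ?m = "measure M (a y ` f y)" and ?k = "measure M (a ?x ` f ?x \<inter> a y ` f y)"
      let ?C = "cylinder f (insert ?x E)"
      have C: "?C = a ?x ` f ?x \<inter> a y ` f y \<inter> cylinder f E"
        using absorb unfolding cylinder_def by auto
      \<comment> \<open>The new edge is used twice, with and without \<open>Q\<close>. Cancelling
        \<open>?m\<close> then transfers the identity for \<open>E\<close> to the larger
        set.\<close>
      have e1: "measure M ?C * ?m = ?k * measure M (cylinder f E)"
        using markov_at_edge[OF yc r fx cyl] unfolding C absorb .
      have e2: "measure M (?C \<inter> Q) * ?m = ?k * measure M (cylinder f E \<inter> Q)"
        using markov_at_edge[OF yc r fx cylQ] absorb unfolding C by (simp add: Int_assoc[symmetric])
      have IH: "measure M (cylinder f E \<inter> Q) * measure M (a d ` f d) =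
          measure M (cylinder f E) * measure M (a d ` f d \<inter> Q)"
        using good unfolding good_def by blast
      have "measure M (?C \<inter> Q) * measure M (a d ` f d) = measure M ?C * measure M (a d ` f d \<inter> Q)"
      proof (cases "?m = 0")
        case True
        have yM: "a y ` f y \<in> sets M" using image_sets[OF yc] fx atoms(1) by blast
        have "?C \<subseteq> a y ` f y" unfolding C by blast
        then have "measure M ?C \<le> ?m" "measure M (?C \<inter> Q) \<le> ?m"
          using yM by (auto intro!: finite_measure_mono)
        then show ?thesis using True by (simp add: measure_le_0_iff)
      next
        case False
        have "(measure M (?C \<inter> Q) * measure M (a d ` f d)) * ?m =
            ?k * (measure M (cylinder f E \<inter> Q) * measure M (a d ` f d))"
          using e2 by (simp add: ac_simps)
        also have "\<dots> = ?k * measure M (cylinder f E) * measure M (a d ` f d \<inter> Q)"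
          using IH by (simp add: ac_simps)
        also have "\<dots> = (measure M ?C * measure M (a d ` f d \<inter> Q)) * ?m"
          unfolding e1[symmetric] by (simp add: ac_simps)
        finally show ?thesis using False by simp
      qed
      then have "good (insert ?x E)"
        using E(1,2) x connected_set_insert[OF E(3) y(2) yc r] unfolding good_def by auto
      then show False using max[of "insert ?x E"] new E(4) by simp
    qed
  qed
  then have "E = insert d V" using E(2) by blast
  then show ?thesis using good unfolding good_def by blast
qed

end

section \<open>The restricted process and its Markov property\<close>

locale schreier_markov_process =
  schreier_transversal G S H D + tree_markov_process G S M a \<alpha>
  for G (structure) and S H D M a \<alpha>
begin

lemma D_facts: "D \<subseteq> carrier G" "finite D" "D \<noteq> {}"
  using D_closed finite_D one_in_D by auto

text \<open>An atom of the join fixes the \<alpha>-class at the source of the exit edge, and the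
  whole atom is measurable over the past of that edge. So \<open>split\<close>, which conditions on
  that class alone, applies both to the atom and to its intersection with \<open>Q\<close>;
  eliminating \<open>?c\<close> and \<open>?m\<close> leaves the claim.\<close>

lemma join_markov_on_atom:
  assumes l: "l \<in> schreier_gens \<times> UNIV"
    and f: "f \<in> D \<rightarrow> \<alpha>" and f': "f' \<in> D \<rightarrow> \<alpha>"
    and Q: "Q \<in> sets (translates M a (carrier G - far l) \<alpha>)"
  shows "measure M (a (letter_value G l) ` cylinder f D \<inter> cylinder f' D \<inter> Q) * measure M (cylinder f' D) =
    measure M (a (letter_value G l) ` cylinder f D \<inter> cylinder f' D) * measure M (cylinder f' D \<inter> Q)"
proof -
  let ?v = "letter_value G l" and ?d = "fst (exit l)" and ?k = "snd (exit l)"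
  let ?V = "?v <# D"
  let ?B = "cylinder f' D" and ?C = "a ?v ` cylinder f D"
  \<comment> \<open>A single labelling for the tile beyond the edge together with its attaching
    point: \<open>f'\<close> at the source, \<open>f\<close> transported by \<open>?v\<close> on the
    tile.\<close>
  define g where "g x = (if x = ?d then f' ?d else f (inv ?v \<otimes> x))" for x
  have v: "?v \<in> H" "?v \<in> carrier G" using letter_value_in_H[OF l] H_closed by auto
  have V: "finite ?V" "connected_set ?V" "?V \<subseteq> half_tree ?d ?k" "?d \<otimes> letter_value G ?k \<in> ?V"
    using finite_D connected_tile[OF v(1)] tile_subset_far[OF l] exit(5)[OF l]
    by (auto simp: far_def l_coset_def)
  have dV: "?d \<notin> ?V" using V(3) source_notin_half_tree[OF exit(2)[OF l]] by blast
  have fV: "f (inv ?v \<otimes> x) \<in> \<alpha>" if "x \<in> ?V" for x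
  proof -
    obtain e where e: "e \<in> D" "x = ?v \<otimes> e" using \<open>x \<in> ?V\<close> by (auto simp: l_coset_def)
    then have "inv ?v \<otimes> x = e" using v(2) D_closed by (auto simp: m_assoc[symmetric])
    then show ?thesis using f e(1) by auto
  qed
  have g: "g \<in> insert ?d ?V \<rightarrow> \<alpha>" using fV f' exit(1)[OF l] by (auto simp: g_def)
  have "?C = cylinder (\<lambda>x. f (inv ?v \<otimes> x)) ?V"
    using image_cylinder[OF v(2) D_facts(1,3)] f atoms(6) by blast
  also have "\<dots> = cylinder g ?V"
    using dV unfolding cylinder_def g_def by (intro INF_cong) auto
  finally have cyl: "cylinder g (insert ?d ?V) = a ?d ` f' ?d \<inter> ?C"
    unfolding cylinder_def by (simp add: g_def)
  have D_past: "D \<subseteq> carrier G - far l" using D_disjnt_far[OF l] D_closed by blast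
  have B: "?B \<in> sets (translates M a (carrier G - far l) \<alpha>)"
    using cylinder_in_translates[OF atoms(1) _ D_past finite_D _ f'] one_in_D by blast
  have B_sub: "?B \<subseteq> a ?d ` f' ?d" using exit(1)[OF l] unfolding cylinder_def by blast
  let ?m = "measure M (a ?d ` f' ?d)" and ?c = "measure M (a ?d ` f' ?d \<inter> ?C)"
  have split: "measure M (?C \<inter> R) * ?m = ?c * measure M R"
    if R: "R \<in> sets (translates M a (carrier G - far l) \<alpha>)" "R \<subseteq> a ?d ` f' ?d" for R
  proof -
    have "measure M (a ?d ` f' ?d \<inter> ?C \<inter> R) * ?m = ?c * measure M (a ?d ` f' ?d \<inter> R)"
      using markov_connected[OF exit(2)[OF l] exit(3)[OF l] V g R(1)[unfolded far_def]]
      unfolding cyl by (simp add: g_def)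
    moreover have "a ?d ` f' ?d \<inter> ?C \<inter> R = ?C \<inter> R" "a ?d ` f' ?d \<inter> R = R" using R(2) by auto
    ultimately show ?thesis by simp
  qed
  have s1: "measure M (?C \<inter> ?B) * ?m = ?c * measure M ?B" using split[OF B B_sub] .
  have s2: "measure M (?C \<inter> ?B \<inter> Q) * ?m = ?c * measure M (?B \<inter> Q)"
    using split[of "?B \<inter> Q"] B Q B_sub by (auto simp: Int_assoc)
  show ?thesis
  proof (cases "?m = 0")
    case True
    have "f' ?d \<in> sets M" using f' exit(1)[OF l] atoms(1) by blast
    then have "a ?d ` f' ?d \<in> sets M" using image_sets exit(2)[OF l] by blast
    then have "measure M ?B \<le> ?m" "measure M (?B \<inter> Q) \<le> ?m"
      using B_sub by (auto intro!: finite_measure_mono)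
    then show ?thesis using True by (simp add: measure_le_0_iff)
  next
    case False
    have "(measure M (?C \<inter> ?B \<inter> Q) * measure M ?B) * ?m = (?c * measure M ?B) * measure M (?B \<inter> Q)"
      using s2 by (simp add: ac_simps)
    also have "\<dots> = (measure M (?C \<inter> ?B) * measure M (?B \<inter> Q)) * ?m"
      unfolding s1[symmetric] by (simp add: ac_simps)
    finally show ?thesis using False by simp
  qed
qed

lemma join_markov:
  assumes l: "l \<in> schreier_gens \<times> UNIV" and B: "B \<in> join_translates D \<alpha>"
  defines "past \<equiv> RPast (G\<lparr>carrier := H\<rparr>) schreier_gens \<one> (letter_value G l)"
  shows "AE x in M.
    real_cond_exp M (translates M a past (join_translates D \<alpha>)) (indicator (a (letter_value G l) ` B)) x =
    real_cond_exp M (sigma (space M) (join_translates D \<alpha>)) (indicator (a (letter_value G l) ` B)) x"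
proof -
  let ?v = "letter_value G l" and ?\<beta> = "join_translates D \<alpha>"
  let ?F = "translates M a past ?\<beta>"
  note part = countable_partition_join[OF partition D_facts]
  note \<beta> = countable_partitionD[OF part]
  have past: "past \<subseteq> carrier G" using H_closed by (auto simp: past_def RPast_def)
  \<comment> \<open>The path with this single edge puts \<open>\<one>\<close> into the past, so the
    join itself is measurable over the past.\<close>
  have "cayley_edge (G\<lparr>carrier := H\<rparr>) schreier_gens \<one> ?v"
    unfolding cayley_edge_def sym_gens_restrict
  proof (intro conjI bexI[of _ ?v])
    show "?v = \<one> \<otimes>\<^bsub>G\<lparr>carrier := H\<rparr>\<^esub> ?v" using T.letter_value_closed[OF l] by simp
  qed (use one_in_H imageI[OF l] in simp_all)
  then have "simple_path (G\<lparr>carrier := H\<rparr>) schreier_gens \<one> ?v [\<one>, ?v]"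
    using letter_value_schreier_neq_one[OF l] by (simp add: simple_path_def)
  then have "\<one> \<in> past" unfolding past_def RPast_def using one_in_H by force
  then have \<beta>F: "?\<beta> \<subseteq> sets ?F"
    using in_translates[OF \<beta>(1) past] image_one[OF \<beta>(6)] by force
  have F_sub: "sets ?F \<subseteq> sets (translates M a (carrier G - far l) \<alpha>)"
  proof (rule translates_join_subset[OF partition D_facts past])
    fix h assume h: "h \<in> past"
    then have "h \<in> H" by (simp add: past_def RPast_def)
    then show "h <# D \<subseteq> carrier G - far l"
      using RPast_tile_disjnt_far[OF l h[unfolded past_def]] tile_closed by blast
  qed blast
  have C: "a ?v ` B \<in> sets M" using image_sets T.letter_value_closed[OF l] B \<beta>(1) by blast
  obtain f where f: "f \<in> D \<rightarrow> \<alpha>" "B = cylinder f D"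
    using B unfolding join_translates_def PiE_def by blast
  show ?thesis
  proof (subst real_cond_exp_partition_iff[OF finite_measure_axioms part
        subalgebra_translates[OF \<beta>(1) past] \<beta>F C], intro ballI)
    fix A Q assume A: "A \<in> ?\<beta>" and Q: "Q \<in> sets ?F"
    obtain f' where f': "f' \<in> D \<rightarrow> \<alpha>" "A = cylinder f' D"
      using A unfolding join_translates_def PiE_def by blast
    show "measure M (a ?v ` B \<inter> A \<inter> Q) * measure M A = measure M (a ?v ` B \<inter> A) * measure M (A \<inter> Q)"
      using join_markov_on_atom[OF l f(1) f'(1) subsetD[OF F_sub Q]] unfolding f(2) f'(2) .
  qed
qed

text \<open>The tiles cover \<open>G\<close>, so the \<open>H\<close>-translates of the join recover
  every \<open>G\<close>-translate of \<open>\<alpha>\<close>.\<close>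

lemma generating_join: "generating (G\<lparr>carrier := H\<rparr>) M a (join_translates D \<alpha>)"
proof -
  have "sets (translates M a (carrier G) \<alpha>) \<subseteq> sets (translates M a H (join_translates D \<alpha>))"
    by (rule translates_subset_translates_join[OF partition D_facts H_closed tiles_cover order_refl])
  moreover have "generating G M a \<alpha>" using markov by (simp add: markov_process_wrt_def)
  ultimately show ?thesis unfolding generating_def by simp blast
qed

lemma markov_process_restrict: "markov_process (G\<lparr>carrier := H\<rparr>) M a"
proof -
  have "markov_process_wrt (G\<lparr>carrier := H\<rparr>) M a schreier_gens (join_translates D \<alpha>)"
    unfolding markov_process_wrt_def sym_gens_restrict
  proof (intro conjI ballI)
    fix B s assume B: "B \<in> join_translates D \<alpha>" and "s \<in> letter_value G ` (schreier_gens \<times> UNIV)"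
    then obtain l where l: "l \<in> schreier_gens \<times> UNIV" "s = letter_value G l" by blast
    then show "AE x in M.
        real_cond_exp M (translates M a (RPast (G\<lparr>carrier := H\<rparr>) schreier_gens \<one>\<^bsub>G\<lparr>carrier := H\<rparr>\<^esub> s)
          (join_translates D \<alpha>)) (indicator (a s ` B)) x =
        real_cond_exp M (sigma (space M) (join_translates D \<alpha>)) (indicator (a s ` B)) x"
      using join_markov[OF l(1) B] by simp
  qed (fact restrict_subgroup[OF subgroup_H] countable_partition_join[OF partition D_facts]
      generating_join)+
  then show ?thesis
    unfolding markov_process_def using free_generating_set_schreier_gens by blast
qed

end

lemma markov_process_finite_index_subgroup:
  assumes "markov_process G N b" "group G" "subgroup H G" "finite (rcosets\<^bsub>G\<^esub> H)"
  shows "markov_process (G\<lparr>carrier := H\<rparr>) N b"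
proof -
  obtain S \<alpha> where S: "free_generating_set G S" "markov_process_wrt G N b S \<alpha>"
    using assms(1) by (auto simp: markov_process_def)
  interpret group G by fact
  interpret free_generators G S
    by unfold_locales (use S(1) in \<open>auto simp: free_generating_set_def\<close>)
  obtain D where "schreier_transversal G S H D"
    using schreier_transversal_exists[OF assms(3,4)] by blast
  then interpret schreier_transversal G S H D .
  interpret schreier_markov_process G S H D N b \<alpha>
    by unfold_locales (fact S(2))
  show ?thesis by (rule markov_process_restrict)
qed

theorem theorem1p3:
  fixes G :: "('g, 'm) monoid_scheme"
    and H :: "'g set"
    and M :: "'a measure"
    and a :: "'g \<Rightarrow> 'a \<Rightarrow> 'a"
  assumes "free_group G"
    and "countable (carrier G)"
    and "subgroup H G"
    and "finite (rcosets\<^bsub>G\<^esub> H)"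
    and "pmp_action G M a"
    and "conjugate_to_markov_process TYPE('b) G M a"
  shows "conjugate_to_markov_process TYPE('b) (G\<lparr>carrier := H\<rparr>) M a"
proof -
  have G: "group G" using assms(1) by (simp add: free_group_def)
  obtain N :: "'b measure" and b where N: "markov_process G N b" "measurably_conjugate G M a N b"
    using assms(6) by (auto simp: conjugate_to_markov_process_def)
  have "H \<subseteq> carrier G" using assms(3) by (rule subgroup.subset)
  \<comment> \<open>The conjugating map and the space \<open>N\<close> are kept, and with them the
    point type \<open>'b\<close>; only fewer group elements have to be respected.\<close>
  then have "measurably_conjugate (G\<lparr>carrier := H\<rparr>) M a N b"
    using N(2) unfolding measurably_conjugate_def by (simp add: subset_iff) blast
  then show ?thesis
    using markov_process_finite_index_subgroup[OF N(1) G assms(3,4)]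
    unfolding conjugate_to_markov_process_def by blast
qed

end
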